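(* Let $G$ be a finite graph with $\mathrm{mad}(G)<22/9$. If $L$ is a 4-assignment for $G$ and $\alpha$ and $\beta$ are $L$-colorings of $G$, then $\alpha$ can be transformed to $\beta$ by an $L$-recoloring sequence in which each vertex is recolored at most 14 times (so that every intermediate coloring is a proper $L$-coloring). In particular, this holds for every planar graph with girth at least 11.
   Context: The maximum average degree of $G$ is $\mathrm{mad}(G):=\max_{H\subseteq G,\,V(H)\neq\emptyset}2|E(H)|/|V(H)|$. A list-assignment $L$ for $G$ assigns to each vertex $v$ a set $L(v)$ of colors; $L$ is a $k$-assignment if $|L(v)|=k$ for every $v$. An $L$-coloring is a proper coloring $\varphi$ with $\varphi(v)\in L(v)$ for all $v$. An $L$-recoloring step changes the color of a single vertex so that the resulting coloring is again a proper $L$-coloring. An $L$-recoloring sequence consists of an initial $L$-coloring followed by a sequence of $L$-recoloring steps; it transforms $\alpha$ to $\beta$ if its initial coloring is $\alpha$ and its final coloring is $\beta$. *)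

theory Defs
  imports "HOL-Analysis.Analysis"
begin

definition simple_graph :: "'a set \<Rightarrow> 'a set set \<Rightarrow> bool" where
  "simple_graph V E \<longleftrightarrow> (\<forall>e\<in>E. e \<subseteq> V \<and> card e = 2)"

definition subgraph :: "'a set \<Rightarrow> 'a set set \<Rightarrow> 'a set \<Rightarrow> 'a set set \<Rightarrow> bool" where
  "subgraph V' E' V E \<longleftrightarrow> simple_graph V' E' \<and> V' \<subseteq> V \<and> E' \<subseteq> E"

text \<open>Meaningful for a finite nonempty vertex set only; on the empty graph the maximum
  ranges over the empty set and its value is unspecified.\<close>

definition mad :: "'a set \<Rightarrow> 'a set set \<Rightarrow> real" where
  "mad V E = Max {2 * real (card E') / real (card V') | V' E'.
                    subgraph V' E' V E \<and> V' \<noteq> {}}"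

definition is_cycle :: "'a set set \<Rightarrow> 'a list \<Rightarrow> bool" where
  "is_cycle E vs \<longleftrightarrow> length vs \<ge> 3 \<and> distinct vs \<and>
     successively (\<lambda>u v. {u, v} \<in> E) vs \<and> {last vs, hd vs} \<in> E"

text \<open>The girth of an acyclic graph is \<open>\<infinity>\<close>, the infimum of the empty set.\<close>

definition girth :: "'a set set \<Rightarrow> enat" where
  "girth E = (INF vs\<in>{vs. is_cycle E vs}. enat (length vs))"

text \<open>A drawing places the vertices at distinct points of the plane and represents each edge
  by an arc joining its two ends; arcs contain no further vertices and meet each other only
  in common ends.\<close>

definition planar_drawing ::
  "'a set \<Rightarrow> 'a set set \<Rightarrow> ('a \<Rightarrow> complex) \<Rightarrow> ('a set \<Rightarrow> real \<Rightarrow> complex) \<Rightarrow> bool" where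
  "planar_drawing V E p \<gamma> \<longleftrightarrow>
     inj_on p V \<and>
     (\<forall>e\<in>E. arc (\<gamma> e) \<and> {pathstart (\<gamma> e), pathfinish (\<gamma> e)} = p ` e \<and>
             path_image (\<gamma> e) \<inter> p ` V \<subseteq> p ` e) \<and>
     (\<forall>e\<in>E. \<forall>f\<in>E. e \<noteq> f \<longrightarrow> path_image (\<gamma> e) \<inter> path_image (\<gamma> f) \<subseteq> p ` (e \<inter> f))"

definition planar :: "'a set \<Rightarrow> 'a set set \<Rightarrow> bool" where
  "planar V E \<longleftrightarrow> (\<exists>p \<gamma>. planar_drawing V E p \<gamma>)"

definition list_assignment :: "nat \<Rightarrow> 'a set \<Rightarrow> ('a \<Rightarrow> 'c set) \<Rightarrow> bool" where
  "list_assignment k V L \<longleftrightarrow> (\<forall>v\<in>V. finite (L v) \<and> card (L v) = k)"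

text \<open>Colorings are extensional functions on \<open>V\<close>, so that equality of colorings
  is equality on \<open>V\<close>.\<close>

definition L_coloring :: "'a set \<Rightarrow> 'a set set \<Rightarrow> ('a \<Rightarrow> 'c set) \<Rightarrow> ('a \<Rightarrow> 'c) \<Rightarrow> bool" where
  "L_coloring V E L \<phi> \<longleftrightarrow> \<phi> \<in> Pi\<^sub>E V L \<and> (\<forall>u v. {u, v} \<in> E \<longrightarrow> \<phi> u \<noteq> \<phi> v)"

definition recoloring_step ::
  "'a set \<Rightarrow> 'a set set \<Rightarrow> ('a \<Rightarrow> 'c set) \<Rightarrow> ('a \<Rightarrow> 'c) \<Rightarrow> ('a \<Rightarrow> 'c) \<Rightarrow> bool" where
  "recoloring_step V E L \<phi> \<psi> \<longleftrightarrow>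
     L_coloring V E L \<phi> \<and> L_coloring V E L \<psi> \<and>
     (\<exists>v\<in>V. \<exists>c. c \<noteq> \<phi> v \<and> \<psi> = \<phi>(v := c))"

definition recoloring_sequence ::
  "'a set \<Rightarrow> 'a set set \<Rightarrow> ('a \<Rightarrow> 'c set) \<Rightarrow> ('a \<Rightarrow> 'c) list \<Rightarrow> bool" where
  "recoloring_sequence V E L \<phi>s \<longleftrightarrow>
     \<phi>s \<noteq> [] \<and> L_coloring V E L (hd \<phi>s) \<and> successively (recoloring_step V E L) \<phi>s"

definition transforms :: "('a \<Rightarrow> 'c) list \<Rightarrow> ('a \<Rightarrow> 'c) \<Rightarrow> ('a \<Rightarrow> 'c) \<Rightarrow> bool" where
  "transforms \<phi>s \<alpha> \<beta> \<longleftrightarrow> hd \<phi>s = \<alpha> \<and> last \<phi>s = \<beta>"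

definition times_recolored :: "('a \<Rightarrow> 'c) list \<Rightarrow> 'a \<Rightarrow> nat" where
  "times_recolored \<phi>s v = card {i. Suc i < length \<phi>s \<and> (\<phi>s ! i) v \<noteq> (\<phi>s ! Suc i) v}"

end

theory Submission
  imports Defs
begin

text \<open>If a vertex \<open>v\<close> with \<open>d \<le> 2\<close> neighbors is added to a graph and these are recolored
  \<open>t\<close> times in total, then looking ahead over \<open>3 - d\<close> of these steps at a time, a list of four
  colors lets \<open>v\<close> survive with at most \<open>\<lceil>t / (3 - d)\<rceil> + 1\<close> recolorings. So it suffices to order the
  vertices, with labels \<open>r v \<le> 14\<close>, such that every vertex has at most two earlier neighbors
  and their labels force no more than \<open>r v\<close>. One earlier neighbor labelled 14 forces 8, one labelled
  8 forces 5, and two labelled 8 and 5 force 14.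

  Such an order exists if \<open>9 e(X) \<le> 11 |X|\<close> for every vertex set \<open>X\<close>. The induction
  carries vertices whose label is capped at 8 or 5, which weigh 9 or 7 instead of 11, and keeps
  the potential (weight minus 9 per edge) of every \<open>X\<close> nonnegative. A proper part of potential at
  most 1 is ordered first and then contracted to a vertex labelled 14. Otherwise some vertex of
  degree 2 can come last, with caps 8 and 5 on its two neighbors: if both ways of assigning the caps
  made a potential negative, two sets of potential at most 3 would together
  with the vertex have potential at most \<open>6 + 11 - 18 < 0\<close>.

  For planar graphs of girth at least 11, a smallest violation of \<open>9 e(X) + 11 \<le> 11 |X|\<close> is 2-connected.
  Splitting along ears bounds the number of edges inside any of its cycles, and a cycle with as many edges
  inside as possible has none outside.\<close>

section \<open>Building orders by a potential argument\<close>

definition deg_in :: "('a \<Rightarrow> 'a \<Rightarrow> nat) \<Rightarrow> 'a set \<Rightarrow> 'a \<Rightarrow> nat" where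
  "deg_in m X v = (\<Sum>u\<in>X. m v u)"

definition load :: "('a \<Rightarrow> 'a \<Rightarrow> nat) \<Rightarrow> ('a \<Rightarrow> nat) \<Rightarrow> 'a set \<Rightarrow> 'a \<Rightarrow> nat" where
  "load m r X v = (\<Sum>u\<in>X. m v u * r u)"

text \<open>The vertices of \<open>T\<close> are given, and the others are placed one at a time;
  \<open>D\<close> is what has been placed so far. With \<open>d\<close> the degree into
  \<open>D\<close> and \<open>k = 3 - d\<close>, the last premise says that \<open>load / k\<close>,
  rounded up as \<open>(load + k - 1) div k\<close>, plus 1 is at most the label. Degrees count
  multiplicities because contraction creates parallel edges.\<close>

inductive built :: "('a \<Rightarrow> 'a \<Rightarrow> nat) \<Rightarrow> ('a \<Rightarrow> nat) \<Rightarrow> 'a set \<Rightarrow> 'a set \<Rightarrow> bool"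
  for m r T where
  start: "built m r T T"
| add: "\<lbrakk>built m r T D; v \<notin> D; deg_in m D v \<le> 2;
         (load m r D v + 2 - deg_in m D v) div (3 - deg_in m D v) + 1 \<le> r v\<rbrakk>
        \<Longrightarrow> built m r T (insert v D)"

lemma built_mono: "built m r T D \<Longrightarrow> T \<subseteq> D"
  by (induction rule: built.induct) auto

lemma built_cong:
  assumes "built m r T D" "\<And>v. v \<in> D \<Longrightarrow> r v = r' v"
  shows "built m r' T D"
  using assms
proof (induction rule: built.induct)
  case start then show ?case by (auto intro: built.start)
next
  case (add D v)
  have "load m r' D v = load m r D v"
    unfolding load_def by (intro sum.cong refl) (use add.prems in auto)
  with add show ?case by (auto intro!: built.add)
qed

lemma built_trans:
  assumes "built m r S D" "built m r T S" shows "built m r T D"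
  using assms by (induction rule: built.induct) (auto intro: built.add)

text \<open>Placing \<open>Q\<close> beforehand changes neither degrees nor loads, as no vertex
  added after \<open>T\<close> is adjacent to \<open>Q\<close>. This allows roots outside a part to
  precede that part.\<close>

lemma built_Un_isolated:
  assumes "built m r T D" "finite D" "finite Q" "D \<inter> Q = {}" "\<And>v u. v \<in> D - T \<Longrightarrow> u \<in> Q \<Longrightarrow> m v u = 0"
  shows "built m r (T \<union> Q) (D \<union> Q)"
  using assms
proof (induction rule: built.induct)
  case start then show ?case by (auto intro: built.start)
next
  case (add D v)
  have vT: "v \<notin> T" using add.hyps built_mono by blast
  have z: "m v u = 0" if "u \<in> Q" for u using add.prems(4)[of v u] that vT by auto
  have 1: "deg_in m (D \<union> Q) v = deg_in m D v" "load m r (D \<union> Q) v = load m r D v"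
    unfolding deg_in_def load_def using add.prems z
    by (subst sum.union_disjoint; auto)+
  have "built m r (T \<union> Q) (D \<union> Q)" by (rule add.IH) (use add.prems in auto)
  then have "built m r (T \<union> Q) (insert v (D \<union> Q))"
    by (rule built.add) (use add 1 in auto)
  then show ?case by simp
qed

lemma need_mono:
  fixes d s s' :: nat assumes "s \<le> s'" shows "(s + 2 - d) div (3 - d) + 1 \<le> (s' + 2 - d) div (3 - d) + 1"
  using assms by (simp add: div_le_mono)

section \<open>Edge counts and the potential\<close>

text \<open>Edges within \<open>X\<close> are counted in both directions by \<open>dbl m X X\<close>.\<close>

definition dbl :: "('a \<Rightarrow> 'a \<Rightarrow> nat) \<Rightarrow> 'a set \<Rightarrow> 'a set \<Rightarrow> nat" where
  "dbl m X Y = (\<Sum>u\<in>X. \<Sum>v\<in>Y. m u v)"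

definition edges_in :: "('a \<Rightarrow> 'a \<Rightarrow> nat) \<Rightarrow> 'a set \<Rightarrow> nat" where
  "edges_in m X = dbl m X X div 2"

definition pot :: "('a \<Rightarrow> 'a \<Rightarrow> nat) \<Rightarrow> ('a \<Rightarrow> int) \<Rightarrow> 'a set \<Rightarrow> int" where
  "pot m f X = sum f X - 9 * int (edges_in m X)"

definition multigraph :: "('a \<Rightarrow> 'a \<Rightarrow> nat) \<Rightarrow> bool" where
  "multigraph m \<longleftrightarrow> (\<forall>u v. m u v = m v u) \<and> (\<forall>u. m u u = 0)"

lemma dbl_sym: "multigraph m \<Longrightarrow> dbl m X Y = dbl m Y X"
  unfolding dbl_def multigraph_def by (subst sum.swap) auto

lemma dbl_Un1: "\<lbrakk>finite A; finite B; A \<inter> B = {}\<rbrakk> \<Longrightarrow> dbl m (A \<union> B) C = dbl m A C + dbl m B C"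
  unfolding dbl_def by (rule sum.union_disjoint)

lemma dbl_Un2: "\<lbrakk>finite A; finite B; A \<inter> B = {}\<rbrakk> \<Longrightarrow> dbl m C (A \<union> B) = dbl m C A + dbl m C B"
  unfolding dbl_def by (simp add: sum.union_disjoint sum.distrib)

lemma dbl_sing: "dbl m {v} X = deg_in m X v"
  by (simp add: dbl_def deg_in_def)

lemma dbl_Un_self:
  assumes "multigraph m" "finite A" "finite B" "A \<inter> B = {}"
  shows "dbl m (A \<union> B) (A \<union> B) = dbl m A A + dbl m B B + 2 * dbl m A B"
  using assms by (simp add: dbl_Un1 dbl_Un2 dbl_sym[of m B A])

lemma even_dbl: assumes "multigraph m" "finite X" shows "even (dbl m X X)"
  using assms(2)
proof induction
  case empty then show ?case by (simp add: dbl_def)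
next
  case (insert x X)
  have "dbl m {x} {x} = 0" using assms by (simp add: dbl_def multigraph_def)
  then show ?case using dbl_Un_self[OF assms(1), of "{x}" X] insert by simp
qed

lemma edges_in_Un:
  assumes "multigraph m" "finite A" "finite B" "A \<inter> B = {}"
  shows "edges_in m (A \<union> B) = edges_in m A + edges_in m B + dbl m A B"
  unfolding edges_in_def dbl_Un_self[OF assms]
  using even_dbl[OF assms(1,2)] even_dbl[OF assms(1,3)] by auto

lemma pot_Un:
  assumes "multigraph m" "finite A" "finite B" "A \<inter> B = {}"
  shows "pot m f (A \<union> B) = pot m f A + pot m f B - 9 * int (dbl m A B)"
  unfolding pot_def edges_in_Un[OF assms] using assms by (simp add: sum.union_disjoint)

lemma pot_sing: "multigraph m \<Longrightarrow> pot m f {v} = f v"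
  by (simp add: pot_def edges_in_def dbl_def multigraph_def)

lemma pot_insert:
  assumes "multigraph m" "finite X" "v \<notin> X"
  shows "pot m f (insert v X) = pot m f X + f v - 9 * int (deg_in m X v)"
  using pot_Un[OF assms(1), of "{v}" X f] assms by (simp add: pot_sing dbl_sing)

text \<open>With both sets split along their intersection, the two sides agree except for the edges
  between \<open>X - Y\<close> and \<open>Y - X\<close>. Only the union contains these, and they
  lower its potential.\<close>

lemma pot_submod:
  assumes "multigraph m" "finite X" "finite Y"
  shows "pot m f (X \<union> Y) + pot m f (X \<inter> Y) \<le> pot m f X + pot m f Y"
proof -
  let ?A = "X - Y" and ?I = "X \<inter> Y" and ?B = "Y - X"
  have fin: "finite ?A" "finite ?I" "finite ?B" using assms by auto
  have 1: "pot m f X = pot m f ?A + pot m f ?I - 9 * int (dbl m ?A ?I)"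
    using pot_Un[OF assms(1) fin(1,2), of f] by (simp add: Int_Diff Un_Diff_Int Diff_Int_distrib2 Int_commute inf.left_commute)
  have 2: "pot m f Y = pot m f ?B + pot m f ?I - 9 * int (dbl m ?B ?I)"
    using pot_Un[OF assms(1) fin(3,2), of f] by (metis Diff_disjoint Int_commute Un_Diff_Int inf_assoc inf_bot_right)
  have "X \<union> Y = X \<union> ?B" by auto
  then have "pot m f (X \<union> Y) = pot m f X + pot m f ?B - 9 * int (dbl m X ?B)"
    using pot_Un[OF assms(1,2) fin(3), of f] by auto
  moreover have "dbl m X ?B = dbl m ?A ?B + dbl m ?I ?B"
    using dbl_Un1[OF fin(1,2), of m ?B] by (metis Diff_disjoint Int_Diff Un_Diff_Int inf.idem inf_commute)
  ultimately show ?thesis using 1 2 dbl_sym[OF assms(1), of ?I ?B] by simp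
qed

lemma pot_fun_upd:
  assumes "finite X"
  shows "pot m (f(p := c)) X = pot m f X - (if p \<in> X then f p - c else 0)"
proof -
  have "sum (f(p := c)) X = sum f X - (if p \<in> X then f p - c else 0)"
  proof (cases "p \<in> X")
    case True
    then show ?thesis using assms by (subst (1 2) sum.remove[of _ p]) (auto intro!: sum.cong)
  next
    case False then show ?thesis by (auto intro!: sum.cong)
  qed
  then show ?thesis by (simp add: pot_def)
qed

text \<open>The handshake identity, which turns the potential of \<open>V\<close> into a sum of
  local charges fit for discharging.\<close>

lemma sum_deg_pot:
  assumes "multigraph m" "finite V"
  shows "(\<Sum>v\<in>V. 2 * f v - 9 * int (deg_in m V v)) = 2 * pot m f V"
proof -
  have "(\<Sum>v\<in>V. int (deg_in m V v)) = 2 * int (edges_in m V)"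
    using even_dbl[OF assms] by (auto simp: edges_in_def dbl_def deg_in_def simp flip: of_nat_sum elim!: evenE)
  then show ?thesis by (simp add: sum_subtractf pot_def flip: sum_distrib_left)
qed


section \<open>Capped labels and the placement of a single vertex\<close>

text \<open>A weight is 11 for an ordinary vertex, 9 or 7 for one whose label must not exceed 8 or 5,
  and 0 or 1 for a contracted part, which precedes everything else with label 14.\<close>

definition cap :: "int \<Rightarrow> nat" where
  "cap c = (if c = 9 then 8 else if c = 7 then 5 else 14)"

definition roots :: "('a \<Rightarrow> int) \<Rightarrow> 'a set \<Rightarrow> 'a set" where
  "roots f V = {v\<in>V. f v \<le> 1}"

definition solvable :: "('a \<Rightarrow> 'a \<Rightarrow> nat) \<Rightarrow> ('a \<Rightarrow> int) \<Rightarrow> 'a set \<Rightarrow> bool" where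
  "solvable m f V \<longleftrightarrow> (\<exists>r. built m r (roots f V) V \<and> (\<forall>v\<in>V. r v \<le> cap (f v)) \<and>
     (\<forall>v\<in>roots f V. r v = 14))"

lemma cap_le: "cap c \<le> 14"
  by (simp add: cap_def)

text \<open>The vertex \<open>v\<close> is appended with label \<open>cap (f v)\<close>. The other
  vertices may be ordered for smaller weights \<open>f'\<close>: lowering the caps of the neighbors
  of \<open>v\<close> is what keeps its load small, and the caps serve as the worst case for that
  load.\<close>

lemma solvable_insert_last:
  assumes "solvable m f' (V - {v})" "v \<in> V" "finite V" "f v > 1"
    and "\<And>u. u \<in> V - {v} \<Longrightarrow> cap (f' u) \<le> cap (f u)"
    and "\<And>u. u \<in> V - {v} \<Longrightarrow> f' u \<le> 1 \<longleftrightarrow> f u \<le> 1"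
    and d: "deg_in m (V - {v}) v \<le> 2"
    and need: "(load m (\<lambda>u. cap (f' u)) (V - {v}) v + 2 - deg_in m (V - {v}) v)
            div (3 - deg_in m (V - {v}) v) + 1 \<le> cap (f v)"
  shows "solvable m f V"
proof -
  obtain r where r: "built m r (roots f' (V - {v})) (V - {v})"
     "\<And>u. u \<in> V - {v} \<Longrightarrow> r u \<le> cap (f' u)" "\<And>u. u \<in> roots f' (V - {v}) \<Longrightarrow> r u = 14"
    using assms(1) unfolding solvable_def by blast
  have "u \<in> roots f' (V - {v}) \<longleftrightarrow> u \<in> roots f V" for u
    using assms(4) assms(6)[of u] by (cases "u = v") (auto simp: roots_def)
  then have R: "roots f' (V - {v}) = roots f V" by blast
  let ?r = "r(v := cap (f v))"
  have "built m ?r (roots f V) (V - {v})"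
    using built_cong[OF r(1), of ?r] R by simp
  moreover have "load m ?r (V - {v}) v \<le> load m (\<lambda>u. cap (f' u)) (V - {v}) v"
    unfolding load_def by (intro sum_mono) (use r(2) in auto)
  then have "(load m ?r (V - {v}) v + 2 - deg_in m (V - {v}) v) div (3 - deg_in m (V - {v}) v) + 1 \<le> ?r v"
    using order_trans[OF need_mono need] by simp
  ultimately have "built m ?r (roots f V) (insert v (V - {v}))"
    using d by (intro built.add) auto
  moreover have "insert v (V - {v}) = V" using assms(2) by auto
  moreover have "v \<notin> roots f V" using assms(4) by (simp add: roots_def)
  ultimately show ?thesis
    unfolding solvable_def using r(2,3) assms(5) R
    by (intro exI[of _ ?r]) (auto intro!: order_trans[OF r(2)])
qed

lemma solvable_insert_isolated_root:
  assumes "solvable m f (V - {t})" "t \<in> V" "finite V" "f t \<le> 1" "multigraph m" "deg_in m V t = 0"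
  shows "solvable m f V"
proof -
  obtain r where r: "built m r (roots f (V - {t})) (V - {t})"
     "\<And>u. u \<in> V - {t} \<Longrightarrow> r u \<le> cap (f u)" "\<And>u. u \<in> roots f (V - {t}) \<Longrightarrow> r u = 14"
    using assms(1) unfolding solvable_def by blast
  have z: "m v t = 0" if "v \<in> V" for v
    using assms that by (auto simp: deg_in_def multigraph_def)
  let ?r = "r(t := 14)"
  have "built m ?r (roots f (V - {t})) (V - {t})"
    using built_cong[OF r(1), of ?r] by simp
  then have "built m ?r (roots f (V - {t}) \<union> {t}) ((V - {t}) \<union> {t})"
    by (rule built_Un_isolated) (use assms z in auto)
  moreover have "(V - {t}) \<union> {t} = V" "roots f (V - {t}) \<union> {t} = roots f V"
    using assms by (auto simp: roots_def)
  moreover have "cap (f t) = 14" using assms by (simp add: cap_def)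
  ultimately show ?thesis
    unfolding solvable_def using r(2,3) by (intro exI[of _ ?r]) (auto simp: roots_def)
qed

section \<open>Contraction of a part to a root\<close>

text \<open>The vertex \<open>y\<close> stands for all of \<open>Y\<close>: parallel edges add up
  and loops are dropped. The other vertices of \<open>Y\<close> keep their old entries, so the
  result is meant for vertex sets that avoid them.\<close>

definition contract :: "('a \<Rightarrow> 'a \<Rightarrow> nat) \<Rightarrow> 'a set \<Rightarrow> 'a \<Rightarrow> 'a \<Rightarrow> 'a \<Rightarrow> nat" where
  "contract m Y y u v = (if u = y then (if v = y then 0 else \<Sum>x\<in>Y. m x v)
      else if v = y then \<Sum>x\<in>Y. m u x else m u v)"

lemma multigraph_contract: "multigraph m \<Longrightarrow> multigraph (contract m Y y)"
  by (auto simp: multigraph_def contract_def)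

lemma pot_cong:
  assumes "\<And>u. u \<in> X \<Longrightarrow> f u = f' u" "\<And>u v. u \<in> X \<Longrightarrow> v \<in> X \<Longrightarrow> m u v = m' u v"
  shows "pot m f X = pot m' f' X"
proof -
  have "sum f X = sum f' X" "dbl m X X = dbl m' X X"
    unfolding dbl_def using assms by (auto intro!: sum.cong)
  then show ?thesis by (simp add: pot_def edges_in_def)
qed

lemma pot_contract_other:
  assumes "y \<notin> Z" shows "pot (contract m Y y) (f(y := c)) Z = pot m f Z"
  by (rule pot_cong) (use assms in \<open>auto simp: contract_def\<close>)

text \<open>The weight \<open>pot m f Y\<close> of the contracted vertex accounts for the vertices
  and edges within \<open>Y\<close>, and its edges to \<open>Z\<close> are those between
  \<open>Y\<close> and \<open>Z\<close>. Hence nonnegative potentials are inherited by the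
  contraction.\<close>

lemma pot_contract:
  assumes "multigraph m" "finite Z" "finite Y" "y \<notin> Z" "Z \<inter> Y = {}"
  shows "pot (contract m Y y) (f(y := pot m f Y)) (insert y Z) = pot m f (Z \<union> Y)"
proof -
  have "deg_in (contract m Y y) Z y = dbl m Y Z"
    unfolding deg_in_def dbl_def contract_def using assms(4)
    by (subst sum.swap) (auto intro!: sum.cong)
  then show ?thesis
    using pot_insert[OF multigraph_contract[OF assms(1)] assms(2,4), of Y y "f(y := pot m f Y)"]
      pot_Un[OF assms(1,2,3,5), of f] dbl_sym[OF assms(1), of Y Z]
    by (simp add: pot_contract_other[OF assms(4)])
qed

text \<open>Replacing \<open>y\<close> by all of \<open>Y\<close> keeps the degree of every later
  vertex and cannot raise its load: \<open>y\<close> contributes 14 along each edge, and no label in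
  \<open>Y\<close> exceeds 14.\<close>

lemma built_uncontract:
  assumes "built (contract m Y y) r' (insert y Q) D" "D \<subseteq> W" "finite W" "finite Y" "W \<inter> Y = {y}" "y \<notin> Q"
    and r: "\<And>u. u \<in> Y \<Longrightarrow> r u \<le> 14" "r' y = 14" "\<And>u. u \<in> W - {y} \<Longrightarrow> r u = r' u"
  shows "built m r (Y \<union> Q) (D - {y} \<union> Y)"
  using assms(1,2)
proof (induction rule: built.induct)
  case start
  have "insert y Q - {y} \<union> Y = Y \<union> Q" using assms by auto
  then show ?case by (metis built.start)
next
  case (add D v)
  have yD: "y \<in> D" using built_mono[OF add.hyps(1)] by auto
  have v: "v \<noteq> y" "v \<notin> Y" using yD add.hyps(2) add.prems assms(5) by auto
  have fin: "finite (D - {y})" "finite D" using add.prems assms(3) finite_subset by auto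
  have disj: "(D - {y}) \<inter> Y = {}" using add.prems assms(5) by auto
  have rr: "r u = r' u" if "u \<in> D" "u \<noteq> y" for u using r(3)[of u] that add.prems by auto
  have deg: "deg_in m (D - {y} \<union> Y) v = deg_in (contract m Y y) D v"
  proof -
    have "deg_in (contract m Y y) D v = (\<Sum>x\<in>Y. m v x) + deg_in m (D - {y}) v"
      unfolding deg_in_def
      by (subst sum.remove[OF fin(2) yD]) (use v in \<open>auto simp: contract_def intro!: sum.cong\<close>)
    then show ?thesis
      unfolding deg_in_def by (subst sum.union_disjoint) (use fin assms(4) disj in auto)
  qed
  have "load m r (D - {y} \<union> Y) v = load m r (D - {y}) v + (\<Sum>x\<in>Y. m v x * r x)"
    unfolding load_def by (subst sum.union_disjoint) (use fin assms(4) disj in auto)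
  also have "\<dots> \<le> load m r (D - {y}) v + (\<Sum>x\<in>Y. m v x * 14)"
    using r(1) by (intro add_left_mono sum_mono) auto
  also have "\<dots> = load (contract m Y y) r' D v"
    unfolding load_def sum.remove[OF fin(2) yD] using v r(2) rr
    by (auto simp: contract_def sum_distrib_right intro!: sum.cong)
  finally have load: "load m r (D - {y} \<union> Y) v \<le> load (contract m Y y) r' D v" .
  have "r v = r' v" using r(3) add.prems v by auto
  moreover have "v \<notin> D - {y} \<union> Y" using v add.hyps by auto
  ultimately have "built m r (Y \<union> Q) (insert v (D - {y} \<union> Y))"
    using add.IH add.prems add.hyps(3,4) need_mono[OF load, of "deg_in m (D - {y} \<union> Y) v"]
    by (intro built.add) (auto simp: deg)
  moreover have "insert v (D - {y} \<union> Y) = insert v D - {y} \<union> Y" using v by auto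
  ultimately show ?case by simp
qed

text \<open>The order consists of the roots, the rest of \<open>Y\<close>, and then the remaining
  vertices. The outside roots may precede \<open>Y\<close> because no edge joins them to it; the
  last stretch is the order of the contracted graph with its root \<open>y\<close> replaced by
  \<open>Y\<close>.\<close>

lemma solvable_uncontract:
  assumes "multigraph m" "finite V" "Y \<subseteq> V" "y \<in> Y"
    and Ysolv: "solvable m f Y"
    and Qsolv: "solvable (contract m Y y) (f(y := c)) (insert y (V - Y))" "c \<le> 1"
    and noedge: "\<And>u v. u \<in> Y \<Longrightarrow> v \<in> V - Y \<Longrightarrow> f v \<le> 1 \<Longrightarrow> m u v = 0"
  shows "solvable m f V"
proof -
  let ?W = "insert y (V - Y)" and ?Q = "roots f V - Y"
  obtain r1 where r1: "built m r1 (roots f Y) Y" "\<And>v. v \<in> Y \<Longrightarrow> r1 v \<le> cap (f v)"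
     "\<And>v. v \<in> roots f Y \<Longrightarrow> r1 v = 14" using Ysolv unfolding solvable_def by blast
  obtain r2 where r2: "built (contract m Y y) r2 (roots (f(y := c)) ?W) ?W"
     "\<And>v. v \<in> ?W \<Longrightarrow> r2 v \<le> cap ((f(y := c)) v)"
     "\<And>v. v \<in> roots (f(y := c)) ?W \<Longrightarrow> r2 v = 14" using Qsolv unfolding solvable_def by blast
  have RW: "roots (f(y := c)) ?W = insert y ?Q"
    using assms(3,4) Qsolv(2) by (auto simp: roots_def)
  have fin: "finite Y" using assms finite_subset by blast
  define r where "r = (\<lambda>v. if v \<in> Y then r1 v else r2 v)"
  have "built m r (roots f Y) Y" using built_cong[OF r1(1), of r] by (simp add: r_def)
  then have "built m r (roots f Y \<union> ?Q) (Y \<union> ?Q)"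
    by (rule built_Un_isolated) (use fin assms(2) noedge in \<open>auto simp: roots_def\<close>)
  moreover have "roots f Y \<union> ?Q = roots f V" using assms(3) by (auto simp: roots_def)
  ultimately have 1: "built m r (roots f V) (Y \<union> ?Q)" by simp
  have "built m r (Y \<union> ?Q) (?W - {y} \<union> Y)"
  proof (rule built_uncontract[of m Y y r2 ?Q ?W ?W])
    show "built (contract m Y y) r2 (insert y ?Q) ?W" using r2(1) RW by simp
    show "r u \<le> 14" if "u \<in> Y" for u using r1(2)[OF that] that cap_le[of "f u"] by (simp add: r_def)
    show "r2 y = 14" using r2(3) RW by simp
  qed (use assms fin in \<open>auto simp: r_def\<close>)
  moreover have "?W - {y} \<union> Y = V" using assms(3,4) by auto
  ultimately have "built m r (roots f V) V" using built_trans 1 by metis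
  moreover have "r v \<le> cap (f v)" if "v \<in> V" for v
  proof (cases "v \<in> Y")
    case True then show ?thesis using r1(2) by (simp add: r_def)
  next
    case False
    then have "v \<noteq> y" "v \<in> ?W" using that assms(4) by auto
    then show ?thesis using r2(2)[of v] False by (simp add: r_def)
  qed
  moreover have "r v = 14" if "v \<in> roots f V" for v
  proof (cases "v \<in> Y")
    case True then show ?thesis using r1(3)[of v] that by (simp add: r_def roots_def)
  next
    case False
    then have "v \<in> roots (f(y := c)) ?W" using that RW by auto
    then show ?thesis using r2(3) False by (simp add: r_def)
  qed
  ultimately show ?thesis unfolding solvable_def by blast
qed

section \<open>Forests and the 2-regular case\<close>

lemma built_forest:
  assumes "finite W" "\<And>X. X \<subseteq> W \<Longrightarrow> X \<noteq> {} \<Longrightarrow> \<exists>v\<in>X. deg_in m X v \<le> 1" "multigraph m"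
  shows "built m (\<lambda>_. 2) {} W"
  using assms
proof (induction "card W" arbitrary: W)
  case 0 then show ?case by (simp add: built.start)
next
  case (Suc n)
  then have "W \<noteq> {}" by auto
  then obtain v where v: "v \<in> W" "deg_in m W v \<le> 1" using Suc.prems(2) by blast
  have d: "deg_in m (W - {v}) v \<le> 1"
    using v Suc.prems(1) by (simp add: deg_in_def sum_diff1_nat)
  have "built m (\<lambda>_. 2) {} (W - {v})"
    using Suc v by (intro Suc.hyps) auto
  \<comment> \<open>Label 2 reproduces itself: one earlier neighbor labelled 2 needs
    \<open>(2 + 2 - 1) div 2 + 1 = 2\<close>, and no earlier neighbor needs 1.\<close>
  moreover have "load m (\<lambda>_. 2) (W - {v}) v = 2 * deg_in m (W - {v}) v"
    by (simp add: load_def deg_in_def sum_distrib_left mult.commute)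
  ultimately have "built m (\<lambda>_. 2) {} (insert v (W - {v}))"
    using d by (intro built.add) (auto simp: le_Suc_eq)
  then show ?case using v by (simp add: insert_absorb)
qed

text \<open>This is the configuration that survives discharging. Deleting a vertex \<open>b\<close>
  leaves a forest, because a set with all inner degrees at least 2 would have potential at most 0.
  The forest gets labels 2, and \<open>b\<close>, placed last with load 4, needs label 5, within its
  cap 8.\<close>

lemma solvable_2_regular:
  assumes "finite V" "V \<noteq> {}" "multigraph m" "\<And>v. v \<in> V \<Longrightarrow> f v = 9" "\<And>v. v \<in> V \<Longrightarrow> deg_in m V v = 2"
    and H: "\<And>Y. Y \<subset> V \<Longrightarrow> 2 \<le> card Y \<Longrightarrow> 2 \<le> pot m f Y"
  shows "solvable m f V"
proof -
  obtain b where b: "b \<in> V" using assms by auto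
  have "\<exists>v\<in>X. deg_in m X v \<le> 1" if X: "X \<subseteq> V - {b}" "X \<noteq> {}" for X
  proof (rule ccontr)
    assume "\<not> ?thesis"
    then have ge: "2 \<le> deg_in m X v" if "v \<in> X" for v using that by force
    have finX: "finite X" using X assms finite_subset by blast
    have "2 * pot m f X = (\<Sum>v\<in>X. 2 * f v - 9 * int (deg_in m X v))"
      using sum_deg_pot[OF assms(3) finX, of f] by simp
    also have "\<dots> \<le> 0" using ge assms(4) X by (intro sum_nonpos) force
    finally have "pot m f X \<le> 0" by simp
    moreover have "X \<subset> V" using X b by auto
    ultimately have "card X < 2" using H[of X] by linarith
    then obtain x where x: "X = {x}" using X finX card_1_singletonE
      by (metis One_nat_def Suc_1 card_gt_0_iff less_2_cases_iff not_less_iff_gr_or_eq)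
    then show False using ge[of x] assms(3) by (simp add: deg_in_def multigraph_def)
  qed
  then have "built m (\<lambda>_. 2) {} (V - {b})"
    using assms(1,3) by (intro built_forest) auto
  then have 1: "built m ((\<lambda>_. 2)(b := 5)) {} (V - {b})"
    by (rule built_cong) auto
  have deg: "deg_in m (V - {b}) b = 2"
    using assms(1,3) assms(5)[OF b] b by (simp add: deg_in_def sum_diff1_nat multigraph_def)
  have "load m ((\<lambda>_. 2)(b := 5)) (V - {b}) b = 2 * deg_in m (V - {b}) b"
    unfolding load_def deg_in_def sum_distrib_left by (intro sum.cong) auto
  then have "built m ((\<lambda>_. 2)(b := 5)) {} (insert b (V - {b}))"
    using 1 deg by (intro built.add) auto
  moreover have "insert b (V - {b}) = V" "roots f V = {}" using b assms(4) by (auto simp: roots_def)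
  ultimately show ?thesis unfolding solvable_def
    using assms(4) by (intro exI[of _ "(\<lambda>_. 2)(b := 5)"]) (auto simp: cap_def)
qed

section \<open>The induction on the number of vertices\<close>

text \<open>The weights vary in the induction: deleting a vertex may lower the weights of its
  neighbors to 9 or 7, and contracting a part creates a weight 0 or 1. After contraction, isolated
  roots and vertices of degree at most 1 have been dealt with, either a vertex of degree 2 can come
  last or discharging leaves a 2-regular graph.\<close>

lemma solvable_if_pot_nonneg:
  fixes m :: "'a \<Rightarrow> 'a \<Rightarrow> nat"
  assumes "multigraph m" "finite V" "\<And>v. v \<in> V \<Longrightarrow> f v \<in> {0,1,7,9,11}"
    and "\<And>X. X \<subseteq> V \<Longrightarrow> 0 \<le> pot m f X"
  shows "solvable m f V"
  using assms
proof (induction "card V" arbitrary: V m f rule: less_induct)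
  case less
  note mg = less.prems(1) and fin = less.prems(2) and fval = less.prems(3) and inv = less.prems(4)
  have IH: "solvable m' f' V'" if "card V' < card V" "multigraph m'" "finite V'"
    "\<And>v. v \<in> V' \<Longrightarrow> f' v \<in> {0,1,7,9,11}" "\<And>X. X \<subseteq> V' \<Longrightarrow> 0 \<le> pot m' f' X" for m' f' and V' :: "'a set"
    by (rule less.hyps[OF that(1-3)]) (fact that(4,5))+
  have IHsub: "solvable m f W" if "W \<subset> V" for W
  proof (rule IH)
    show "card W < card V" using that fin psubset_card_mono by blast
    show "finite W" using that fin finite_subset by blast
    show "f v \<in> {0,1,7,9,11}" if "v \<in> W" for v using fval \<open>W \<subset> V\<close> that by blast
    show "0 \<le> pot m f X" if "X \<subseteq> W" for X using inv \<open>W \<subset> V\<close> that by blast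
  qed (rule mg)
  have IHdel: "solvable m f' (V - {v})" if "v \<in> V" "\<And>u. u \<in> V - {v} \<Longrightarrow> f' u \<in> {0,1,7,9,11}"
      "\<And>X. X \<subseteq> V - {v} \<Longrightarrow> 0 \<le> pot m f' X" for f' v
  proof (rule IH)
    show "card (V - {v}) < card V" using that(1) fin by (meson card_Diff1_less)
  qed (use fin mg that in blast)+
  have sub: "deg_in m X v \<le> deg_in m V v" if "X \<subseteq> V" for X v
    unfolding deg_in_def using fin that by (intro sum_mono2) auto
  have finX: "finite X" if "X \<subseteq> V" for X using that fin finite_subset by blast
  have msym: "m u v = m v u" for u v using mg by (simp add: multigraph_def)
  have noloop: "m u u = 0" for u using mg by (simp add: multigraph_def)
  have pot_ins: "pot m f (insert v X) = pot m f X + f v - 9 * int (deg_in m X v)"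
    if "X \<subseteq> V" "v \<notin> X" for v X using pot_insert[OF mg finX[OF that(1)] that(2)] .
  have m_le: "m v u \<le> deg_in m X v" if "u \<in> X" "X \<subseteq> V" for u v X
    unfolding deg_in_def using finX[OF that(2)] that(1) by (simp add: member_le_sum)
  have ex_one: "\<exists>p\<in>X. m v p = 1 \<and> (\<forall>u\<in>X. p \<noteq> u \<longrightarrow> m v u = 0)"
    if "deg_in m X v = 1" "finite X" for X v
    using that(1) sum_eq_1_iff[OF that(2), of "m v"] by (simp only: deg_in_def)
  show ?case
  proof (cases "V = {}")
    case True
    then show ?thesis by (auto simp: solvable_def roots_def intro: built.start)
  next
    case False
    consider (dense) Y where "Y \<subset> V" "2 \<le> card Y" "pot m f Y \<le> 1"
      | (isolated) t where "t \<in> V" "f t \<le> 1" "deg_in m V t = 0"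
      | (leaf) v where "v \<in> V" "f v > 1" "deg_in m V v \<le> 1"
      | (rest) "\<not> (\<exists>Y. Y \<subset> V \<and> 2 \<le> card Y \<and> pot m f Y \<le> 1)"
               "\<not> (\<exists>t. t \<in> V \<and> f t \<le> 1 \<and> deg_in m V t = 0)"
               "\<not> (\<exists>v. v \<in> V \<and> f v > 1 \<and> deg_in m V v \<le> 1)"
      by blast
    then show ?thesis
    proof cases
      case dense
      have finY: "finite Y" using dense finX by auto
      obtain y where y: "y \<in> Y" using dense(2) by fastforce
      \<comment> \<open>The potential of \<open>Y\<close> is itself a root weight, so the contracted
        graph stays within the admissible weights.\<close>
      have c: "pot m f Y \<in> {0,1}" using dense inv[of Y] by auto
      let ?W = "insert y (V - Y)"
      have cardW: "card ?W < card V"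
      proof -
        have "card ?W = Suc (card V - card Y)"
          using y fin finY dense(1) by (simp add: card_Diff_subset psubset_imp_subset)
        moreover have "card Y < card V" using dense(1) fin psubset_card_mono by blast
        ultimately show ?thesis using dense(2) by linarith
      qed
      show ?thesis
      proof (rule solvable_uncontract[OF mg fin, of Y y f "pot m f Y"])
        show "solvable m f Y"
          using dense(1) by (rule IHsub)
        show "solvable (contract m Y y) (f(y := pot m f Y)) ?W"
        proof (rule IH[OF cardW multigraph_contract[OF mg]])
          show "(f(y := pot m f Y)) v \<in> {0,1,7,9,11}" if "v \<in> ?W" for v
            using that c fval[of v] by auto
          fix X assume X: "X \<subseteq> ?W"
          show "0 \<le> pot (contract m Y y) (f(y := pot m f Y)) X"
          proof (cases "y \<in> X")
            case True
            have "pot (contract m Y y) (f(y := pot m f Y)) (insert y (X - {y})) = pot m f ((X - {y}) \<union> Y)"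
              using X y fin finY by (intro pot_contract mg) (auto intro: finite_subset)
            moreover have "(X - {y}) \<union> Y \<subseteq> V" using X dense(1) by auto
            ultimately show ?thesis using inv True by (simp add: insert_absorb)
          next
            case False
            then show ?thesis using X inv[of X] dense(1) by (auto simp: pot_contract_other)
          qed
        qed (use fin in auto)
        \<comment> \<open>A root \<open>v\<close> adjacent to \<open>Y\<close> would give
          \<open>insert v Y\<close> a potential of at most \<open>1 + 1 - 9 < 0\<close>.\<close>
        show "m u v = 0" if "u \<in> Y" "v \<in> V - Y" "f v \<le> 1" for u v
        proof (rule ccontr)
          assume "m u v \<noteq> 0"
          then have "1 \<le> deg_in m Y v" using m_le[of u Y v] that dense(1) msym[of u v] by auto
          then show False using pot_ins[of Y v] inv[of "insert v Y"] that dense by auto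
        qed
      qed (use dense y c in auto)
    next
      case isolated
      have "solvable m f (V - {t})"
        using isolated(1) by (intro IHsub) auto
      then show ?thesis using isolated fin mg by (intro solvable_insert_isolated_root[of m f V t])
    next
      case leaf
      have d: "deg_in m (V - {v}) v \<le> 1" using sub[of "V - {v}" v] leaf(3) by auto
      have fv: "f v = 7 \<or> f v = 9 \<or> f v = 11" using fval[OF leaf(1)] leaf(2) by auto
      show ?thesis
      \<comment> \<open>One earlier neighbor of label at most 14 forces at most
        \<open>15 div 2 + 1 = 8\<close>, so a leaf of weight 9 or 11 can come last without any
        change of weights. Only a leaf capped at 5 has to restrict its neighbor.\<close>
      proof (cases "f v = 7 \<and> deg_in m (V - {v}) v = 1")
        case False
        have "solvable m f (V - {v})"
          using leaf(1) by (intro IHsub) auto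
        moreover have "load m (\<lambda>u. cap (f u)) (V - {v}) v \<le> 14 * deg_in m (V - {v}) v"
          unfolding load_def deg_in_def sum_distrib_left
          by (intro sum_mono) (metis cap_le mult.commute mult_le_mono2)
        ultimately show ?thesis
          using leaf(1,2) fin d fv False
          by (intro solvable_insert_last[of m f V v f]) (auto simp: cap_def le_Suc_eq)
      next
        case True
        then obtain p where p: "p \<in> V - {v}" "m v p = 1" "\<And>u. u \<in> V - {v} - {p} \<Longrightarrow> m v u = 0"
          using ex_one[of "V - {v}" v] fin by (metis Diff_iff finite_Diff singletonI)
        \<comment> \<open>If \<open>p\<close> were a root, the pair would have potential at most
          \<open>1 + 7 - 9 < 0\<close>.\<close>
        have fp: "f p > 1"
        proof (rule ccontr)
          assume "\<not> ?thesis"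
          moreover have "pot m f (insert v {p}) = f p + f v - 9"
            using pot_ins[of "{p}" v] p by (auto simp: pot_sing[OF mg] deg_in_def)
          ultimately show False using inv[of "insert v {p}"] p leaf(1) True by auto
        qed
        \<comment> \<open>A label of at most 8 at \<open>p\<close> forces only
          \<open>9 div 2 + 1 = 5\<close> at \<open>v\<close>. The at most 2 units of weight lost at
          \<open>p\<close> are available: adding \<open>v\<close> to a set that contains
          \<open>p\<close> changes its potential by \<open>7 - 9 = -2\<close> and must leave it
          nonnegative.\<close>
        define f' where "f' = f(p := min (f p) 9)"
        have f': "f' p \<in> {7,9}" using fval[of p] p fp by (auto simp: f'_def)
        have "solvable m f' (V - {v})"
        proof (rule IHdel[OF leaf(1)])
          show "f' u \<in> {0,1,7,9,11}" if "u \<in> V - {v}" for u using that fval[of u] f' by (auto simp: f'_def)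
          fix X assume X: "X \<subseteq> V - {v}"
          then have XV: "X \<subseteq> V" and fX: "finite X" and vX: "v \<notin> X" using finX by auto
          show "0 \<le> pot m f' X"
          proof (cases "p \<in> X")
            case False then show ?thesis using inv[OF XV] fX by (simp add: f'_def pot_fun_upd)
          next
            case pX: True
            have "deg_in m X v \<le> 1" using sub[OF XV, of v] leaf(3) by simp
            then have "0 \<le> pot m f X - 2"
              using pot_ins[OF XV vX] XV inv[of "insert v X"] True leaf(1) m_le[OF pX XV, of v] p(2) by auto
            moreover have "pot m f' X \<ge> pot m f X - 2"
              using pX fX fval[of p] p by (auto simp: f'_def pot_fun_upd)
            ultimately show ?thesis by simp
          qed
        qed
        moreover have "load m (\<lambda>u. cap (f' u)) (V - {v}) v = cap (f' p)"
        proof -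
          have "load m (\<lambda>u. cap (f' u)) (V - {v}) v = m v p * cap (f' p)"
            unfolding load_def using fin p by (subst sum.remove[of _ p]) auto
          then show ?thesis using p by simp
        qed
        moreover have "cap (f' u) \<le> cap (f u)" "f' u \<le> 1 \<longleftrightarrow> f u \<le> 1" if "u \<in> V - {v}" for u
          using fval[of u] that fp by (auto simp: f'_def cap_def min_def)
        ultimately show ?thesis
          using leaf(1,2) fin True f'
          by (intro solvable_insert_last[of m f' V v f]) (auto simp: cap_def)
      qed
    next
      case rest
      have H: "2 \<le> pot m f Y" if "Y \<subset> V" "2 \<le> card Y" for Y using rest(1) that by force
      have dT: "1 \<le> deg_in m V t" if "t \<in> V" "f t \<le> 1" for t
        using rest(2) that by (metis One_nat_def Suc_leI gr0I)
      have dS: "2 \<le> deg_in m V v" if "v \<in> V" "f v > 1" for v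
        using rest(3) that by force
      show ?thesis
      \<comment> \<open>The vertex \<open>b\<close> sought here is uncapped and will come last. Its
        neighbors must not be roots, since the label 14 of a root cannot be lowered.\<close>
      proof (cases "\<exists>b\<in>V. f b = 11 \<and> deg_in m V b = 2 \<and> (\<forall>t\<in>V. f t \<le> 1 \<longrightarrow> m b t = 0)")
        case True
        then obtain b where b: "b \<in> V" "f b = 11" "deg_in m V b = 2"
          "\<And>t. t \<in> V \<Longrightarrow> f t \<le> 1 \<Longrightarrow> m b t = 0" by blast
        define W where "W = V - {b}"
        have W: "W \<subseteq> V" "finite W" "b \<notin> W" "W \<subset> V" using fin b by (auto simp: W_def)
        have degW: "deg_in m W b = 2"
          using b(1,3) fin noloop[of b] by (simp add: W_def deg_in_def sum_diff1_nat)
        \<comment> \<open>Such an \<open>X\<close> receives both edges of \<open>b\<close>, so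
          adding \<open>b\<close> changes its potential by \<open>11 - 18 = -7\<close>.\<close>
        have big: "7 \<le> pot m f X" if "X \<subseteq> W" "deg_in m X b = 2" for X
        proof -
          have "X \<subseteq> V" "b \<notin> X" "insert b X \<subseteq> V" using that(1) W(1,3) b(1) by auto
          then show ?thesis using pot_ins[of X b] inv[of "insert b X"] that(2) b(2) by auto
        qed
        \<comment> \<open>Caps 8 and 5 keep the load of \<open>b\<close> at most 13, so that label
          \<open>13 + 1 = 14\<close> suffices. For \<open>p = q\<close> the second update wins and
          the cap is 5.\<close>
        define upd where "upd p q = f(p := min (f p) 9, q := min (f q) 7)" for p q
        have step: "solvable m f V" if pq: "p \<in> W" "q \<in> W" "f p > 1" "f q > 1"
            "\<And>X. X \<subseteq> W \<Longrightarrow> 0 \<le> pot m (upd p q) X" "load m (\<lambda>u. cap (upd p q u)) W b \<le> 13" for p q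
        proof -
          have val: "f p = 7 \<or> f p = 9 \<or> f p = 11" "f q = 7 \<or> f q = 9 \<or> f q = 11"
            using fval[of p] fval[of q] W pq by auto
          have "solvable m (upd p q) (V - {b})"
          proof (rule IHdel[OF b(1)])
            show "upd p q u \<in> {0,1,7,9,11}" if "u \<in> V - {b}" for u
              using fval[of u] that val by (auto simp: upd_def)
            show "0 \<le> pot m (upd p q) X" if "X \<subseteq> V - {b}" for X using pq(5) that by (simp add: W_def)
          qed
          moreover have "cap (upd p q u) \<le> cap (f u)" "upd p q u \<le> 1 \<longleftrightarrow> f u \<le> 1" for u
            using val by (auto simp: upd_def cap_def)
          ultimately show ?thesis
            using b(1,2) fin degW pq(6)
            by (intro solvable_insert_last[of m "upd p q" V b f]) (auto simp: W_def[symmetric] cap_def)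
        qed
        have nbr: "f u > 1" if "u \<in> W" "m b u \<noteq> 0" for u using b(4)[of u] that W by fastforce
        obtain p where p: "p \<in> W" "m b p \<noteq> 0"
          using degW by (metis deg_in_def sum.neutral zero_neq_numeral)
        have fp: "f p = 7 \<or> f p = 9 \<or> f p = 11" using nbr[OF p] fval[of p] p(1) W(1) by auto
        have rem: "deg_in m W b = m b p + deg_in m (W - {p}) b"
          unfolding deg_in_def using W p by (simp add: sum.remove)
        show ?thesis
        proof (cases "m b p = 1")
          case False
          \<comment> \<open>Both edges of \<open>b\<close> lead to \<open>p\<close>. Cap 5 gives
            load 10, and the loss of at most 4 in weight is covered by the potential 7 of every set
            containing \<open>p\<close>.\<close>
          then have mp: "m b p = 2" using rem degW p by linarith
          then have "deg_in m (W - {p}) b = 0" using rem degW by simp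
          then have z: "m b u = 0" if "u \<in> W - {p}" for u using that W by (auto simp: deg_in_def)
          show ?thesis
          proof (rule step[of p p])
            fix X assume X: "X \<subseteq> W"
            have "deg_in m X b = 2" if "p \<in> X"
              using that mp sub[of X b] subset_trans[OF X W(1)] b(3) m_le[of p X b] by auto
            then show "0 \<le> pot m (upd p p) X"
              using big[OF X] inv[of X] subset_trans[OF X W(1)] fp finite_subset[OF X W(2)]
              by (cases "p \<in> X") (auto simp: upd_def pot_fun_upd)
          next
            have "load m (\<lambda>u. cap (upd p p u)) W b = m b p * cap (upd p p p)"
              unfolding load_def using W p z by (subst sum.remove[of _ p]) auto
            moreover have "upd p p p = 7" using fp by (auto simp: upd_def)
            ultimately show "load m (\<lambda>u. cap (upd p p u)) W b \<le> 13" by (simp add: cap_def mp)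
          qed (use p nbr in auto)
        next
          case True
          then have "deg_in m (W - {p}) b = 1" using rem degW by simp
          then obtain q where q: "q \<in> W - {p}" "m b q = 1" "\<And>u. u \<in> W - {p} - {q} \<Longrightarrow> m b u = 0"
            using ex_one[of "W - {p}" b] W(2) by (metis Diff_iff finite_Diff singletonI)
          have deg2: "deg_in m X b = 2" if "X \<subseteq> W" "p \<in> X" "q \<in> X" for X
          proof -
            have "deg_in m {p,q} b \<le> deg_in m X b"
              unfolding deg_in_def using finite_subset[OF that(1) W(2)] that by (intro sum_mono2) auto
            moreover have "deg_in m {p,q} b = 2" using q(1,2) True by (auto simp: deg_in_def)
            ultimately show ?thesis using sub[of X b] that W b(3) by auto
          qed
          have vp: "f x = 7 \<or> f x = 9 \<or> f x = 11" if "x \<in> {p,q}" for x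
            using that fval[of x] nbr[of x] p q W by auto
          \<comment> \<open>A set containing both neighbors has potential at least 7 and loses at
            most \<open>2 + 4\<close>. A set with only \<open>x\<close> loses at most 2, which
            \<open>H\<close> covers unless it is \<open>{x}\<close>, whose weight stays positive.
            Hence a failing set contains \<open>y\<close> alone; as it loses at most 4, its
            potential was at most 3.\<close>
          have blocked: "\<exists>X\<subseteq>W. y \<in> X \<and> x \<notin> X \<and> pot m f X \<le> 3"
            if xy: "{x,y} = {p,q}" "X \<subseteq> W" "pot m (upd x y) X < 0" for x y X
          proof (intro exI conjI)
            have ne: "x \<noteq> y" using xy(1) q by (auto simp: doubleton_eq_iff)
            have fX: "finite X" using xy W finite_subset by blast
            have eq: "pot m (upd x y) X = pot m f X - (if x \<in> X then f x - min (f x) 9 else 0)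
                - (if y \<in> X then f y - min (f y) 7 else 0)"
              using ne fX by (simp add: upd_def pot_fun_upd)
            have val: "f x = 7 \<or> f x = 9 \<or> f x = 11" "f y = 7 \<or> f y = 9 \<or> f y = 11"
              using vp xy(1) by auto
            have nonneg: "0 \<le> pot m f X" using inv[of X] xy(2) W by auto
            have "y \<in> X \<and> x \<notin> X"
            proof (rule ccontr)
              assume "\<not> ?thesis"
              then consider "x \<notin> X" "y \<notin> X" | "x \<in> X" "y \<in> X" | "x \<in> X" "y \<notin> X" by blast
              then show False
              proof cases
                case 1 then show False using eq xy(3) nonneg by simp
              next
                case 2
                then have "7 \<le> pot m f X" using big[OF xy(2)] deg2[OF xy(2)] xy(1) by (auto simp: doubleton_eq_iff)
                then show False using eq xy(3) val 2 by auto
              next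
                case 3
                show False
                proof (cases "X = {x}")
                  case True
                  then show False using eq xy(3) val 3 by (auto simp: pot_sing[OF mg])
                next
                  case False
                  then have "2 \<le> card X" using 3 fX
                    by (metis One_nat_def Suc_1 card_1_singletonE card_eq_0_iff empty_iff insertE le_less_Suc_eq not_less_eq_eq less_one linorder_not_le)
                  then have "2 \<le> pot m f X" using H xy(2) W by blast
                  then show False using eq xy(3) val 3 by auto
                qed
              qed
            qed
            then show "y \<in> X" "x \<notin> X" by auto
            then show "pot m f X \<le> 3" using eq xy(3) val by auto
          qed (fact xy(2))
          have "(\<forall>X\<subseteq>W. 0 \<le> pot m (upd p q) X) \<or> (\<forall>X\<subseteq>W. 0 \<le> pot m (upd q p) X)"
          proof (rule ccontr)
            assume "\<not> ?thesis"
            then obtain X1 X2 where "X1 \<subseteq> W" "pot m (upd p q) X1 < 0" "X2 \<subseteq> W" "pot m (upd q p) X2 < 0"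
              by (auto simp: not_le)
            then obtain X Y where X: "X \<subseteq> W" "q \<in> X" "pot m f X \<le> 3" and Y: "Y \<subseteq> W" "p \<in> Y" "pot m f Y \<le> 3"
              using blocked[of p q X1] blocked[of q p X2] by blast
            \<comment> \<open>The union of the two obstructions contains both neighbors of
              \<open>b\<close>, yet submodularity bounds its potential by
              \<open>3 + 3\<close>.\<close>
            have "7 \<le> pot m f (X \<union> Y)" by (intro big deg2) (use X Y in auto)
            moreover have "0 \<le> pot m f (X \<inter> Y)" using X W by (intro inv) auto
            ultimately show False
              using pot_submod[OF mg, of X Y f] X Y W(2) finite_subset by fastforce
          qed
          moreover have ld: "load m (\<lambda>u. cap (g u)) W b = cap (g p) + cap (g q)" for g :: "'a \<Rightarrow> int"
          proof -
            have "load m (\<lambda>u. cap (g u)) W b = m b p * cap (g p) + m b q * cap (g q)"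
              unfolding load_def using W p(1) q
              by (subst sum.remove[of _ p]; (subst sum.remove[of _ q])?) auto
            then show ?thesis using True q by simp
          qed
          have "cap (upd p q p) + cap (upd p q q) \<le> 13" "cap (upd q p p) + cap (upd q p q) \<le> 13"
            using vp[of p] vp[of q] q(1) by (auto simp: upd_def cap_def)
          then have "load m (\<lambda>u. cap (upd p q u)) W b \<le> 13" "load m (\<lambda>u. cap (upd q p u)) W b \<le> 13"
            unfolding ld by auto
          ultimately show ?thesis
            using step[of p q] step[of q p] p q nbr by auto
        qed
      next
        case False
        define T where "T = roots f V"
        define B where "B = {v\<in>V. f v = 11 \<and> deg_in m V v = 2}"
        \<comment> \<open>Discharging: the charges \<open>g\<close> sum to
          \<open>2 * pot m f V \<ge> 0\<close>. Each vertex of \<open>B\<close> has charge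
          \<open>22 - 18 = 4\<close> and a root as neighbor, to which it can send this charge. A
          root receives at most 4 per edge, so \<open>2 - 9 * deg + 4 * deg\<close> bounds what it
          ends up with; \<open>h\<close> records these bounds.\<close>
        define g where "g v = 2 * f v - 9 * int (deg_in m V v)" for v
        define h where "h v = (if v \<in> T then 2 - 5 * int (deg_in m V v) else if v \<in> B then 0 else g v)" for v
        have TV: "T \<subseteq> V" "finite T" "B \<subseteq> V" "finite B" "T \<inter> B = {}"
          using fin by (auto simp: T_def B_def roots_def)
        have "card B \<le> (\<Sum>b\<in>B. \<Sum>t\<in>T. m b t)"
        proof -
          have "1 \<le> (\<Sum>t\<in>T. m b t)" if bB: "b \<in> B" for b
          proof -
            obtain t where "t \<in> T" "m b t \<noteq> 0" using False bB by (auto simp: B_def T_def roots_def)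
            then show ?thesis using member_le_sum[of t T "m b"] TV(2) by simp
          qed
          then show ?thesis using sum_mono[of B "\<lambda>_. 1" "\<lambda>b. \<Sum>t\<in>T. m b t"] by simp
        qed
        also have "\<dots> = (\<Sum>t\<in>T. deg_in m B t)"
          unfolding deg_in_def by (subst sum.swap) (simp add: msym)
        also have "\<dots> \<le> (\<Sum>t\<in>T. deg_in m V t)"
          by (intro sum_mono sub TV)
        finally have cB: "int (card B) \<le> (\<Sum>t\<in>T. int (deg_in m V t))" by (simp flip: of_nat_sum)
        have "0 \<le> (\<Sum>v\<in>V. g v)"
          unfolding g_def using sum_deg_pot[OF mg fin, of f] inv[of V] by simp
        also have "\<dots> \<le> (\<Sum>v\<in>V. h v + (if v \<in> B then 4 else 0) - (if v \<in> T then 4 * int (deg_in m V v) else 0))"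
          by (intro sum_mono) (auto simp: h_def g_def B_def T_def roots_def)
        also have "\<dots> = (\<Sum>v\<in>V. h v) + 4 * int (card B) - 4 * (\<Sum>t\<in>T. int (deg_in m V t))"
          using fin TV by (simp add: sum.distrib sum_subtractf sum.If_cases Int_absorb1 sum_distrib_left
              flip: sum.inter_restrict)
        finally have "0 \<le> (\<Sum>v\<in>V. h v)" using cB by simp
        \<comment> \<open>A root has at most \<open>2 - 5\<close>. A vertex outside \<open>B\<close>
          of weight 11 has degree at least 3 and at most \<open>22 - 27\<close>; weights 9 and 7
          come with degree at least 2, giving at most \<open>18 - 18\<close> and
          \<open>14 - 18\<close>. As the sum is nonnegative, every value must be 0, which leaves
          only weight 9 with degree 2.\<close>
        moreover have hle: "h v \<le> 0" if "v \<in> V" for v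
          using fval[OF that] dT[OF that] dS[OF that] that by (auto simp: h_def g_def B_def T_def roots_def)
        ultimately have "(\<Sum>v\<in>V. h v) = 0" using sum_nonpos[of V h] by fastforce
        then have h0: "h v = 0" if "v \<in> V" for v
          using sum_nonneg_eq_0_iff[OF fin, of "\<lambda>v. - h v"] hle that by (auto simp: sum_negf)
        have T: "T = {}"
        proof (rule ccontr)
          assume "T \<noteq> {}"
          then obtain t where "t \<in> T" by blast
          then show False using h0[of t] TV dT[of t] by (auto simp: h_def T_def roots_def) presburger
        qed
        have f9: "f v = 9 \<and> deg_in m V v = 2" if "v \<in> V" for v
        proof -
          have "v \<notin> B" using False T that by (auto simp: B_def T_def roots_def)
          then show ?thesis
            using h0[OF that] fval[OF that] dS[OF that] T that by (auto simp: h_def g_def B_def T_def roots_def) presburger+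
        qed
        show ?thesis
          by (rule solvable_2_regular[OF fin \<open>V \<noteq> {}\<close> mg]) (use f9 H in auto)
      qed
    qed
  qed
qed

section \<open>Extending recoloring sequences to a new vertex\<close>

definition ind_edges :: "'a set set \<Rightarrow> 'a set \<Rightarrow> 'a set set" where
  "ind_edges E D = {e\<in>E. e \<subseteq> D}"

abbreviation col :: "'a set set \<Rightarrow> ('a \<Rightarrow> 'c set) \<Rightarrow> 'a set \<Rightarrow> ('a \<Rightarrow> 'c) \<Rightarrow> bool" where
  "col E L D \<equiv> L_coloring D (ind_edges E D) L"

abbreviation recol :: "'a set set \<Rightarrow> ('a \<Rightarrow> 'c set) \<Rightarrow> 'a set \<Rightarrow> ('a \<Rightarrow> 'c) list \<Rightarrow> bool" where
  "recol E L D \<equiv> recoloring_sequence D (ind_edges E D) L"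

section \<open>Recoloring sequences built step by step\<close>

lemma times_recolored_single [simp]: "times_recolored [\<phi>] v = 0"
  by (simp add: times_recolored_def)

lemma times_recolored_Cons2:
  "times_recolored (\<phi> # \<psi> # \<phi>s) v = (if \<phi> v \<noteq> \<psi> v then 1 else 0) + times_recolored (\<psi> # \<phi>s) v"
proof -
  let ?l = "\<phi> # \<psi> # \<phi>s"
  let ?S = "{i. Suc i < length (\<psi> # \<phi>s) \<and> ((\<psi> # \<phi>s) ! i) v \<noteq> ((\<psi> # \<phi>s) ! Suc i) v}"
  have fin: "finite ?S" by (rule finite_subset[of _ "{..<length (\<psi> # \<phi>s)}"]) auto
  have "{i. Suc i < length ?l \<and> (?l ! i) v \<noteq> (?l ! Suc i) v}
      = (if \<phi> v \<noteq> \<psi> v then {0} else {}) \<union> Suc ` ?S"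
  proof (intro set_eqI)
    fix i show "i \<in> {i. Suc i < length ?l \<and> (?l ! i) v \<noteq> (?l ! Suc i) v} \<longleftrightarrow>
        i \<in> (if \<phi> v \<noteq> \<psi> v then {0} else {}) \<union> Suc ` ?S"
      by (cases i) auto
  qed
  moreover have "card ((if \<phi> v \<noteq> \<psi> v then {0} else {}) \<union> Suc ` ?S) = (if \<phi> v \<noteq> \<psi> v then 1 else 0) + card ?S"
    using fin by (auto simp: card_image card_insert_if)
  ultimately show ?thesis unfolding times_recolored_def by (simp only:)
qed

lemma recoloring_sequence_single: "recoloring_sequence V E L [\<phi>] \<longleftrightarrow> L_coloring V E L \<phi>"
  by (simp add: recoloring_sequence_def)

lemma recoloring_sequence_Cons2:
  "recoloring_sequence V E L (\<phi> # \<psi> # \<phi>s) \<longleftrightarrow> recoloring_step V E L \<phi> \<psi> \<and> recoloring_sequence V E L (\<psi> # \<phi>s)"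
  by (auto simp: recoloring_sequence_def recoloring_step_def)

section \<open>Looking ahead along a sequence\<close>

text \<open>The colors on \<open>N\<close> that a new neighbor of \<open>N\<close> should avoid in order to survive the
  next \<open>j\<close> recolorings within \<open>N\<close>.\<close>

fun ahead :: "'a set \<Rightarrow> nat \<Rightarrow> ('a \<Rightarrow> 'c) list \<Rightarrow> 'c set" where
  "ahead N j [] = {}"
| "ahead N j [\<phi>] = \<phi> ` N"
| "ahead N j (\<phi> # \<psi> # \<phi>s) = \<phi> ` N \<union>
     (if \<forall>u\<in>N. \<phi> u = \<psi> u then ahead N j (\<psi> # \<phi>s)
      else if j = 0 then {} else ahead N (j - 1) (\<psi> # \<phi>s))"

lemma ahead_hd: "\<phi> ` N \<subseteq> ahead N j (\<phi> # \<phi>s)"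
  by (cases \<phi>s) auto

lemma ahead_0: "ahead N 0 (\<phi> # \<phi>s) = \<phi> ` N"
proof (induction \<phi>s arbitrary: \<phi>)
  case (Cons \<psi> \<phi>s)
  then show ?case by (auto simp: image_iff)
qed simp

lemma finite_ahead: "finite N \<Longrightarrow> finite (ahead N j \<phi>s)"
  by (induction N j \<phi>s rule: ahead.induct) auto

text \<open>The first coloring shows at most \<open>card N\<close> colors on \<open>N\<close>, and
  each recoloring within \<open>N\<close> brings at most one new color.\<close>

lemma card_ahead:
  assumes "finite N" "successively (\<lambda>\<phi> \<psi>. \<exists>v c. \<psi> = \<phi>(v := c)) \<phi>s"
  shows "card (ahead N j \<phi>s) \<le> card N + j"
  using assms
proof (induction N j \<phi>s rule: ahead.induct)
  case (1 N j) then show ?case by simp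
next
  case (2 N j \<phi>) then show ?case using card_image_le[of N \<phi>] by simp
next
  case (3 N j \<phi> \<psi> \<phi>s)
  show ?case
  proof (cases "\<forall>u\<in>N. \<phi> u = \<psi> u")
    case True
    then have "\<phi> ` N = \<psi> ` N" by auto
    then have "ahead N j (\<phi> # \<psi> # \<phi>s) = ahead N j (\<psi> # \<phi>s)"
      using True ahead_hd[of \<psi> N j \<phi>s] by auto
    then show ?thesis using 3 True by auto
  next
    case False
    show ?thesis
    proof (cases "j = 0")
      case True
      then show ?thesis using False 3(3) card_image_le[of N \<phi>] by auto
    next
      case j: False
      obtain v c where vc: "\<psi> = \<phi>(v := c)" using 3(4) unfolding successively.simps by blast
      \<comment> \<open>The two colorings differ only at \<open>v\<close>, so every color of
        \<open>\<phi>\<close> on \<open>N\<close> other than \<open>\<phi> v\<close> is seen again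
        in \<open>\<psi>\<close>.\<close>
      have "ahead N j (\<phi> # \<psi> # \<phi>s) \<subseteq> insert (\<phi> v) (ahead N (j - 1) (\<psi> # \<phi>s))"
        using False j ahead_hd[of \<psi> N "j - 1" \<phi>s] vc by (auto split: if_splits)
      then have "card (ahead N j (\<phi> # \<psi> # \<phi>s)) \<le> card (insert (\<phi> v) (ahead N (j - 1) (\<psi> # \<phi>s)))"
        by (intro card_mono finite.insertI finite_ahead 3(3))
      also have "\<dots> \<le> Suc (card (ahead N (j - 1) (\<psi> # \<phi>s)))"
        by (simp add: card_insert_if finite_ahead 3(3))
      finally have "card (ahead N j (\<phi> # \<psi> # \<phi>s)) \<le> Suc (card (ahead N (j - 1) (\<psi> # \<phi>s)))" .
      then show ?thesis using 3 False j by auto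
    qed
  qed
qed

lemma sum_times_Cons2:
  assumes "finite N" "\<psi> = \<phi>(x := c)" "c \<noteq> \<phi> x"
  shows "(\<Sum>u\<in>N. times_recolored (\<phi> # \<psi> # \<phi>s) u)
    = (if x \<in> N then 1 else 0) + (\<Sum>u\<in>N. times_recolored (\<psi> # \<phi>s) u)"
proof -
  have "(\<Sum>u\<in>N. if \<phi> u \<noteq> \<psi> u then 1 else 0) = (\<Sum>u\<in>N. if u = x then 1 else (0::nat))"
    using assms by (intro sum.cong) auto
  then show ?thesis
    by (simp add: times_recolored_Cons2 sum.distrib assms(1))
qed

lemma L_coloring_extend:
  assumes "v \<notin> D" "simple_graph V E" "c \<in> L v"
    and N: "N = {u\<in>D. {u,v} \<in> E}"
    and "col E L D \<phi>" "c \<notin> \<phi> ` N"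
  shows "col E L (insert v D) (\<phi>(v := c))"
  unfolding L_coloring_def
proof (intro conjI allI impI)
  show "\<phi>(v := c) \<in> Pi\<^sub>E (insert v D) L"
    using assms by (auto simp: L_coloring_def PiE_iff extensional_def)
  fix x y assume xy: "{x, y} \<in> ind_edges E (insert v D)"
  have "card {x,y} = 2" using xy assms(2) by (auto simp: ind_edges_def simple_graph_def)
  then have ne: "x \<noteq> y" by auto
  consider "x = v" "y \<in> N" | "y = v" "x \<in> N" | "x \<noteq> v" "y \<noteq> v" "{x,y} \<in> ind_edges E D"
    using xy ne N assms(1) by (auto simp: ind_edges_def insert_commute)
  then show "(\<phi>(v := c)) x \<noteq> (\<phi>(v := c)) y"
  proof cases
    case 3 then show ?thesis using assms(5) by (auto simp: L_coloring_def)
  qed (use assms(6) ne in \<open>auto simp: image_iff\<close>)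
qed

text \<open>The color \<open>c\<close> of \<open>v\<close> is known to survive the next
  \<open>j\<close> recolorings within \<open>N\<close>. When \<open>j\<close> is 0 and
  \<open>N\<close> is about to change, some color in \<open>L v\<close> avoids everything seen on
  \<open>N\<close> during the next \<open>k\<close> such recolorings, as these show at most
  \<open>card N + k\<close> colors. Moving \<open>v\<close> to it pays for \<open>k\<close>
  recolorings at once. So \<open>v\<close> moves at most once per \<open>k\<close> recolorings after
  the first \<open>j\<close>, rounded up; the truncated difference gives 0 if \<open>j\<close>
  covers all of them. The final color \<open>c'\<close> is whatever results.\<close>

lemma recoloring_extend:
  assumes vD: "v \<notin> D" and G: "simple_graph V E" and fN: "finite N"
    and N: "N = {u\<in>D. {u,v} \<in> E}"
    and L: "finite (L v)" "card N + k < card (L v)" "0 < k"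
    and "recol E L D \<phi>s" "c \<in> L v" "c \<notin> ahead N j \<phi>s" "j \<le> k"
  shows "\<exists>\<psi>s c'. recol E L (insert v D) \<psi>s \<and> hd \<psi>s = (hd \<phi>s)(v := c) \<and> last \<psi>s = (last \<phi>s)(v := c')
      \<and> (\<forall>u\<in>D. times_recolored \<psi>s u = times_recolored \<phi>s u)
      \<and> times_recolored \<psi>s v \<le> ((\<Sum>u\<in>N. times_recolored \<phi>s u) - j + k - 1) div k"
  using assms(8-11)
proof (induction \<phi>s arbitrary: c j rule: induct_list012)
  case 1 then show ?case by (simp add: recoloring_sequence_def)
next
  case (2 \<phi>)
  have "col E L (insert v D) (\<phi>(v := c))"
    using 2 by (intro L_coloring_extend[OF vD G _ N]) (auto simp: recoloring_sequence_single)
  then show ?case by (intro exI[of _ "[\<phi>(v := c)]"] exI[of _ c]) (simp add: recoloring_sequence_single)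
next
  case (3 \<phi> \<psi> \<phi>s)
  let ?t = "\<lambda>\<phi>s. \<Sum>u\<in>N. times_recolored \<phi>s u"
  have seq: "recol E L D (\<psi> # \<phi>s)" and st: "recoloring_step D (ind_edges E D) L \<phi> \<psi>"
    using 3(3) by (auto simp: recoloring_sequence_Cons2)
  have col: "col E L D \<phi>" "col E L D \<psi>" using st by (auto simp: recoloring_step_def)
  obtain x d where xd: "x \<in> D" "d \<noteq> \<phi> x" "\<psi> = \<phi>(x := d)" using st by (auto simp: recoloring_step_def)
  have xv: "x \<noteq> v" using xd vD by auto
  have ext: "col E L (insert v D) (\<xi>(v := e))" if "e \<in> L v" "e \<notin> \<xi> ` N" "col E L D \<xi>" for \<xi> e
    by (rule L_coloring_extend[OF vD G that(1) N that(3,2)])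
  have step: "recoloring_step (insert v D) (ind_edges E (insert v D)) L (\<phi>(v := e)) (\<psi>(v := e))"
    if "e \<in> L v" "e \<notin> \<phi> ` N" "e \<notin> \<psi> ` N" for e
    unfolding recoloring_step_def using that col ext xd xv by (auto intro!: bexI[of _ x] exI[of _ d])
  define Q where "Q e b \<longleftrightarrow> (\<exists>\<psi>s c'. recol E L (insert v D) \<psi>s \<and> hd \<psi>s = \<phi>(v := e) \<and> last \<psi>s = (last (\<psi> # \<phi>s))(v := c')
      \<and> (\<forall>u\<in>D. times_recolored \<psi>s u = times_recolored (\<phi> # \<psi> # \<phi>s) u)
      \<and> times_recolored \<psi>s v \<le> b)" for e b
  have go: "Q e ((?t (\<psi> # \<phi>s) - i + k - 1) div k)"
    if e: "e \<in> L v" "e \<notin> \<phi> ` N" "e \<notin> ahead N i (\<psi> # \<phi>s)" "i \<le> k" for e i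
  proof -
    obtain \<psi>s c' where *: "recol E L (insert v D) \<psi>s" "hd \<psi>s = \<psi>(v := e)" "last \<psi>s = (last (\<psi> # \<phi>s))(v := c')"
      "\<And>u. u \<in> D \<Longrightarrow> times_recolored \<psi>s u = times_recolored (\<psi> # \<phi>s) u"
      "times_recolored \<psi>s v \<le> (?t (\<psi> # \<phi>s) - i + k - 1) div k"
      using 3(2)[OF seq e(1,3,4)] unfolding list.sel by blast
    obtain \<xi>s where \<xi>s: "\<psi>s = \<psi>(v := e) # \<xi>s"
      using *(1,2) by (cases \<psi>s) (auto simp: recoloring_sequence_def)
    have "e \<notin> \<psi> ` N" using ahead_hd[of \<psi> N i \<phi>s] e(3) by blast
    then have "recoloring_step (insert v D) (ind_edges E (insert v D)) L (\<phi>(v := e)) (\<psi>(v := e))"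
      using step e by auto
    then show ?thesis using * vD unfolding \<xi>s Q_def
      by (intro exI[of _ "\<phi>(v := e) # \<psi>(v := e) # \<xi>s"] exI[of _ c'])
        (auto simp: recoloring_sequence_Cons2 times_recolored_Cons2)
  qed
  have rel: "(\<forall>u\<in>N. \<phi> u = \<psi> u) \<longleftrightarrow> x \<notin> N" using xd by auto
  have t: "?t (\<phi> # \<psi> # \<phi>s) = (if x \<in> N then 1 else 0) + ?t (\<psi> # \<phi>s)"
    using sum_times_Cons2[OF fN xd(3,2)] .
  have cN: "c \<notin> \<phi> ` N" using ahead_hd[of \<phi> N j "\<psi> # \<phi>s"] 3(5) by blast
  have Qmono: "Q e b \<Longrightarrow> b \<le> b' \<Longrightarrow> Q e b'" for e b b'
    unfolding Q_def by (meson order_trans)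
  have "Q c ((?t (\<phi> # \<psi> # \<phi>s) - j + k - 1) div k)"
  proof (cases "x \<in> N")
    case False
    then show ?thesis using go[of c j] 3(4-6) cN rel t by auto
  next
    case True
    show ?thesis
    proof (cases "j = 0")
      case False
      then have "?t (\<psi> # \<phi>s) - (j - 1) = ?t (\<phi> # \<psi> # \<phi>s) - j" using t True by auto
      then show ?thesis using go[of c "j - 1"] 3(4-6) cN rel True False by auto
    next
      case j: True
      have "successively (\<lambda>\<phi> \<psi>. \<exists>v c. \<psi> = \<phi>(v := c)) (\<phi> # \<psi> # \<phi>s)"
        using 3(3) unfolding recoloring_sequence_def
        by (auto simp del: successively.simps elim!: successively_mono simp: recoloring_step_def)
      then have "card (ahead N k (\<phi> # \<psi> # \<phi>s)) < card (L v)"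
        using card_ahead[OF fN] L(2) le_less_trans by blast
      then obtain e where e: "e \<in> L v" "e \<notin> ahead N k (\<phi> # \<psi> # \<phi>s)"
        by (meson card_mono finite_ahead fN not_le subsetI)
      have eN: "e \<notin> \<phi> ` N" using ahead_hd[of \<phi> N k "\<psi> # \<phi>s"] e(2) by blast
      \<comment> \<open>The step at \<open>x\<close> that follows is the first of the
        \<open>k\<close> recolorings which \<open>e\<close> survives.\<close>
      have "e \<notin> ahead N (k - 1) (\<psi> # \<phi>s)" using e(2) rel True L(3) by auto
      then obtain \<psi>s c' where *: "recol E L (insert v D) \<psi>s" "hd \<psi>s = \<phi>(v := e)" "last \<psi>s = (last (\<psi> # \<phi>s))(v := c')"
        "\<And>u. u \<in> D \<Longrightarrow> times_recolored \<psi>s u = times_recolored (\<phi> # \<psi> # \<phi>s) u"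
        "times_recolored \<psi>s v \<le> (?t (\<psi> # \<phi>s) - (k - 1) + k - 1) div k"
        using go[of e "k - 1"] e(1) eN diff_le_self unfolding Q_def by blast
      \<comment> \<open>The numerators differ by a full block of \<open>k\<close>, unless fewer than
        \<open>k\<close> recolorings of \<open>N\<close> remain after this step. In that case the
        look-ahead covers them all, the left side is 1, and the right side is at least 1.\<close>
      have bound: "Suc ((?t (\<psi> # \<phi>s) - (k - 1) + k - 1) div k) \<le> (?t (\<phi> # \<psi> # \<phi>s) - j + k - 1) div k"
      proof -
        have "(?t (\<psi> # \<phi>s) - (k - 1) + k - 1) + k \<le> ?t (\<phi> # \<psi> # \<phi>s) - j + k - 1
            \<or> ?t (\<psi> # \<phi>s) < k"
          using t True j L(3) by auto
        moreover have "Suc (a div k) = (a + k) div k" for a using L(3) by simp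
        ultimately show ?thesis using t True j L(3)
          by (auto simp: div_le_mono Suc_le_eq div_greater_zero_iff)
      qed
      show ?thesis
      \<comment> \<open>A recoloring step has to change a color, so no step at \<open>v\<close> is
        inserted when the chosen color is the current one.\<close>
      proof (cases "e = c")
        case True
        then have "Q c ((?t (\<psi> # \<phi>s) - (k - 1) + k - 1) div k)" unfolding Q_def using * by blast
        then show ?thesis by (rule Qmono) (use bound in simp)
      next
        case False
        obtain \<xi>s where \<xi>s: "\<psi>s = \<phi>(v := e) # \<xi>s"
          using *(1,2) by (cases \<psi>s) (auto simp: recoloring_sequence_def)
        have "recoloring_step (insert v D) (ind_edges E (insert v D)) L (\<phi>(v := c)) (\<phi>(v := e))"
          unfolding recoloring_step_def using ext[of c \<phi>] ext[of e \<phi>] col 3(4) cN e(1) eN False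
          by (auto intro!: bexI[of _ v] exI[of _ e])
        then show ?thesis using * bound vD False unfolding \<xi>s Q_def
          by (intro exI[of _ "\<phi>(v := c) # \<phi>(v := e) # \<xi>s"] exI[of _ c'])
            (auto simp: recoloring_sequence_Cons2 times_recolored_Cons2)
      qed
    qed
  qed
  then show ?case
    unfolding Q_def by (simp only: list.sel last_ConsR list.distinct not_False_eq_True)
qed

lemma L_coloring_last: "recoloring_sequence V E L \<phi>s \<Longrightarrow> L_coloring V E L (last \<phi>s)"
proof (induction \<phi>s rule: induct_list012)
  case 1 then show ?case by (simp add: recoloring_sequence_def)
qed (simp_all add: recoloring_sequence_single recoloring_sequence_Cons2)

lemma recoloring_sequence_snoc:
  assumes "recoloring_sequence V E L \<phi>s" "recoloring_step V E L (last \<phi>s) \<psi>"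
  shows "recoloring_sequence V E L (\<phi>s @ [\<psi>])"
  using assms by (auto simp: recoloring_sequence_def successively_append_iff)

lemma times_recolored_snoc:
  assumes "\<phi>s \<noteq> []"
  shows "times_recolored (\<phi>s @ [\<psi>]) v = times_recolored \<phi>s v + (if last \<phi>s v \<noteq> \<psi> v then 1 else 0)"
  using assms
proof (induction \<phi>s rule: induct_list012)
  case (3 \<phi> \<xi> \<phi>s)
  then show ?case by (simp add: times_recolored_Cons2)
qed (auto simp: times_recolored_Cons2)

text \<open>Each vertex of the order is inserted into the sequence found for the earlier ones. The
  \<open>+ 1\<close> in \<open>built\<close> pays for a last step that brings the new vertex to its
  color in \<open>\<beta>\<close>, after all its earlier neighbors have reached theirs.\<close>

lemma recoloring_if_built:
  fixes E :: "'a set set" and L :: "'a \<Rightarrow> 'c set"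
  assumes G: "finite V" "simple_graph V E" and L: "list_assignment 4 V L"
    and m: "\<And>u v. m u v = (if {u, v} \<in> E then 1 else 0)"
    and "built m r {} D" "D \<subseteq> V" "L_coloring V E L \<alpha>" "L_coloring V E L \<beta>"
  shows "\<exists>\<phi>s. recol E L D \<phi>s \<and> transforms \<phi>s (restrict \<alpha> D) (restrict \<beta> D) \<and>
      (\<forall>v\<in>D. times_recolored \<phi>s v \<le> r v)"
  using assms(5,6)
proof (induction rule: built.induct)
  case start
  have "restrict \<alpha> {} = restrict \<beta> {}" by (simp add: fun_eq_iff)
  moreover have "col E L {} (restrict \<beta> {})"
    using G(2) by (auto simp: L_coloring_def ind_edges_def simple_graph_def)
  ultimately show ?case
    by (intro exI[of _ "[restrict \<beta> {}]"]) (auto simp: recoloring_sequence_single transforms_def)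
next
  case (add D v)
  define N where "N = {u\<in>D. {u,v} \<in> E}"
  define k where "k = 3 - card N"
  have vV: "v \<in> V" and DV: "D \<subseteq> V" using add.prems by auto
  have fD: "finite D" using DV G(1) finite_subset by blast
  have fN: "finite N" using fD by (simp add: N_def)
  have fil: "{u\<in>D. {v,u} \<in> E} = N" by (auto simp: N_def insert_commute)
  have deg: "deg_in m D v = card N"
    using fD fil by (simp add: deg_in_def m sum.If_cases Int_def)
  have load: "load m r D v = (\<Sum>u\<in>N. r u)"
  proof -
    have "load m r D v = (\<Sum>u\<in>D. if {v,u} \<in> E then r u else 0)"
      unfolding load_def m by (intro sum.cong) auto
    then show ?thesis using fD fil by (simp add: sum.If_cases Int_def)
  qed
  obtain \<phi>s where \<phi>s: "recol E L D \<phi>s" "hd \<phi>s = restrict \<alpha> D" "last \<phi>s = restrict \<beta> D"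
    "\<And>v. v \<in> D \<Longrightarrow> times_recolored \<phi>s v \<le> r v"
    using add.IH DV unfolding transforms_def by blast
  have k: "0 < k" "card N + k = 3" using add.hyps(3) deg by (auto simp: k_def)
  have Lv: "finite (L v)" "card (L v) = 4" using L vV by (auto simp: list_assignment_def)
  have upd: "(restrict \<gamma> D)(v := \<gamma> v) = restrict \<gamma> (insert v D)" for \<gamma> :: "'a \<Rightarrow> 'c"
    by (auto simp: fun_eq_iff)
  have proper: "\<gamma> v \<notin> restrict \<gamma> D ` N" "\<gamma> v \<in> L v" if "L_coloring V E L \<gamma>" for \<gamma>
    using that vV by (auto simp: L_coloring_def N_def PiE_iff split: if_splits) metis
  obtain \<psi>s c' where \<psi>s: "recol E L (insert v D) \<psi>s" "hd \<psi>s = (hd \<phi>s)(v := \<alpha> v)" "last \<psi>s = (last \<phi>s)(v := c')"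
     "\<And>u. u \<in> D \<Longrightarrow> times_recolored \<psi>s u = times_recolored \<phi>s u"
     "times_recolored \<psi>s v \<le> ((\<Sum>u\<in>N. times_recolored \<phi>s u) + k - 1) div k"
  proof -
    have "\<phi>s \<noteq> []" using \<phi>s(1) by (auto simp: recoloring_sequence_def)
    then have "\<phi>s = restrict \<alpha> D # tl \<phi>s" using \<phi>s(2) by (metis list.collapse)
    \<comment> \<open>That \<open>\<alpha>\<close> is proper guarantees only that
      \<open>\<alpha> v\<close> avoids the initial colors on \<open>N\<close>, so the look-ahead
      starts at 0.\<close>
    then have "\<alpha> v \<notin> ahead N 0 \<phi>s" using proper(1)[OF assms(7)] by (metis ahead_0)
    then show ?thesis
      using recoloring_extend[OF add.hyps(2) G(2) fN N_def Lv(1) _ k(1) \<phi>s(1) proper(2)[OF assms(7)], of 0]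
        k(2) Lv(2) that by auto
  qed
  define t where "t = (\<Sum>u\<in>N. times_recolored \<phi>s u)"
  have "t \<le> (\<Sum>u\<in>N. r u)" unfolding t_def by (intro sum_mono \<phi>s(4)) (auto simp: N_def)
  then have "(t + 2 - card N) div (3 - card N) + 1 \<le> r v"
    using order_trans[OF need_mono add.hyps(4)] by (simp add: deg load)
  moreover have "t + 2 - card N = t + k - 1" "3 - card N = k" using k by auto
  ultimately have rv: "times_recolored \<psi>s v + 1 \<le> r v" using \<psi>s(5) by (simp add: t_def)
  have ne: "\<psi>s \<noteq> []" using \<psi>s(1) by (auto simp: recoloring_sequence_def)
  have last: "last \<psi>s = (restrict \<beta> D)(v := c')" using \<psi>s(3) \<phi>s(3) by simp
  have hd: "hd \<psi>s = restrict \<alpha> (insert v D)" using \<psi>s(2) \<phi>s(2) upd[of \<alpha>] by simp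
  have old: "times_recolored \<psi>s u \<le> r u" if "u \<in> D" for u using \<psi>s(4) \<phi>s(4) that by simp
  show ?case
  proof (cases "c' = \<beta> v")
    case True
    then show ?thesis using \<psi>s(1) last hd upd[of \<beta>] rv old
      by (intro exI[of _ \<psi>s]) (auto simp: transforms_def)
  next
    case False
    let ?\<beta> = "restrict \<beta> (insert v D)"
    have "col E L D (restrict \<beta> D)" using L_coloring_last[OF \<phi>s(1)] \<phi>s(3) by simp
    then have "col E L (insert v D) ((restrict \<beta> D)(v := \<beta> v))"
      using L_coloring_extend[where \<phi> = "restrict \<beta> D" and c = "\<beta> v"] add.hyps(2) G(2) proper[OF assms(8)] N_def by blast
    then have col\<beta>: "col E L (insert v D) ?\<beta>" using upd by simp
    have "?\<beta> = (last \<psi>s)(v := \<beta> v)" using last upd[of \<beta>] by simp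
    then have "recoloring_step (insert v D) (ind_edges E (insert v D)) L (last \<psi>s) ?\<beta>"
      unfolding recoloring_step_def using col\<beta> L_coloring_last[OF \<psi>s(1)] False last by auto
    then have "recol E L (insert v D) (\<psi>s @ [?\<beta>])" using recoloring_sequence_snoc[OF \<psi>s(1)] by blast
    moreover have "times_recolored (\<psi>s @ [?\<beta>]) u \<le> r u" if "u \<in> insert v D" for u
      using that rv old[of u] last add.hyps(2) by (auto simp: times_recolored_snoc[OF ne])
    ultimately show ?thesis using hd ne by (intro exI[of _ "\<psi>s @ [?\<beta>]"]) (auto simp: transforms_def)
  qed
qed

section \<open>Arcs and closed curves in the plane\<close>

lemma connected_subset_inside:
  assumes "connected S" "S \<inter> T = {}" "S \<inter> inside T \<noteq> {}"
  shows "S \<subseteq> inside T"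
proof
  fix y assume y: "y \<in> S"
  obtain x where x: "x \<in> S" "x \<in> inside T" using assms by auto
  have "connected_component (- T) x y"
    unfolding connected_component_def using assms x y by auto
  then show "y \<in> inside T" using x inside_same_component by blast
qed

lemma connected_subset_outside:
  assumes "connected S" "S \<inter> T = {}" "S \<inter> outside T \<noteq> {}"
  shows "S \<subseteq> outside T"
proof
  fix y assume y: "y \<in> S"
  obtain x where x: "x \<in> S" "x \<in> outside T" using assms by auto
  have "connected_component (- T) x y"
    unfolding connected_component_def using assms x y by auto
  then show "y \<in> outside T" using x outside_same_component by blast
qed

text \<open>The arc without its ends is connected, and both ends lie in its closure, so any of them
  may be added.\<close>

lemma connected_arc_with_ends:
  fixes g :: "real \<Rightarrow> 'a::metric_space"
  assumes "arc g" "A \<subseteq> {pathstart g, pathfinish g}"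
  shows "connected ((path_image g - {pathstart g, pathfinish g}) \<union> A)"
proof (rule connected_intermediate_closure)
  let ?O = "path_image g - {pathstart g, pathfinish g}"
  show "connected ?O" using assms connected_simple_path_endless arc_imp_simple_path by blast
  have O: "?O = g ` {0<..<1}" using assms simple_path_endless arc_imp_simple_path by blast
  have "g ` closure {0<..<1::real} \<subseteq> closure (g ` {0<..<1})"
    using assms(1) by (intro image_closure_subset closed_closure closure_subset) (auto simp: arc_def path_def)
  then have "path_image g \<subseteq> closure ?O" unfolding O by (simp add: path_image_def)
  moreover have "A \<subseteq> path_image g" using assms(2) by auto
  ultimately show "?O \<union> A \<subseteq> closure ?O" by auto
qed auto

lemma arcs_loop:
  assumes "arc g1" "arc g2" "pathstart g1 = a" "pathfinish g1 = b" "pathstart g2 = a" "pathfinish g2 = b"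
    "path_image g1 \<inter> path_image g2 = {a, b}"
  shows "simple_path (g1 +++ reversepath g2)" "path_image (g1 +++ reversepath g2) = path_image g1 \<union> path_image g2"
    "pathfinish (g1 +++ reversepath g2) = pathstart (g1 +++ reversepath g2)"
proof -
  show "simple_path (g1 +++ reversepath g2)"
    by (rule simple_path_join_loop) (use assms in \<open>auto simp: arc_reversepath\<close>)
qed (use assms in \<open>auto simp: path_image_join\<close>)

text \<open>Suppose a point \<open>z\<close> inside the first two arcs lay outside both closed
  curves through \<open>g\<close>. Neither of these separates \<open>z\<close> from a point
  \<open>w\<close> far away, and they meet in the connected set \<open>path_image g\<close>, so by
  Janiszewski's theorem their union does not separate \<open>z\<close> from \<open>w\<close> either.
  But the curve formed by \<open>g1\<close> and \<open>g2\<close> does. Connectedness carries the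
  conclusion from \<open>z\<close> to the whole inside.\<close>

lemma theta_outside:
  fixes g1 g2 g :: "real \<Rightarrow> complex"
  assumes "arc g1" "arc g2" "arc g"
    and "pathstart g1 = a" "pathfinish g1 = b" "pathstart g2 = a" "pathfinish g2 = b"
      "pathstart g = a" "pathfinish g = b"
    and I12: "path_image g1 \<inter> path_image g2 = {a, b}"
    and I1: "path_image g1 \<inter> path_image g = {a, b}" and I2: "path_image g2 \<inter> path_image g = {a, b}"
    and out: "path_image g \<inter> inside (path_image g1 \<union> path_image g2) = {}"
  shows "inside (path_image g1 \<union> path_image g2) \<subseteq> inside (path_image g1 \<union> path_image g) \<or>
    inside (path_image g1 \<union> path_image g2) \<subseteq> inside (path_image g2 \<union> path_image g)"
proof -
  let ?G = "path_image g1 \<union> path_image g2" and ?S = "path_image g1 \<union> path_image g" and ?T = "path_image g2 \<union> path_image g"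
  note J = Jordan_inside_outside[OF arcs_loop(1,3)[OF assms(1,2,4-7) I12], unfolded arcs_loop(2)[OF assms(1,2,4-7) I12]]
  obtain z where z: "z \<in> inside ?G" using J by auto
  have zn: "z \<notin> ?S" "z \<notin> ?T" using z out inside_no_overlap by blast+
  have comp: "compact ?S" "compact ?T" using assms(1-3) by (auto intro!: compact_Un compact_arc_image)
  have "z \<in> inside ?S \<or> z \<in> inside ?T"
  proof (rule ccontr)
    assume "\<not> ?thesis"
    then have zout: "z \<in> outside ?S" "z \<in> outside ?T" using zn inside_Un_outside by blast+
    have "bounded (?S \<union> ?T)" unfolding bounded_Un[of ?S ?T] using comp compact_imp_bounded by blast
    then have "outside (?S \<union> ?T) \<noteq> {}" by (rule outside_bounded_nonempty)
    then obtain w where w: "w \<in> outside (?S \<union> ?T)" by auto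
    have wS: "w \<in> outside ?S" "w \<in> outside ?T" "w \<in> outside ?G"
      using w outside_mono[of ?S "?S \<union> ?T"] outside_mono[of ?T "?S \<union> ?T"] outside_mono[of ?G "?S \<union> ?T"] by auto
    have cc: "connected_component (- X) z w" if "compact X" "z \<in> outside X" "w \<in> outside X" for X :: "complex set"
    proof -
      have "connected (outside X)" using that(1) by (intro connected_outside compact_imp_bounded) auto
      moreover have "outside X \<subseteq> - X" using outside_no_overlap[of X] by blast
      ultimately show ?thesis unfolding connected_component_def using that(2,3) by blast
    qed
    have "?S \<inter> ?T = path_image g" using I12 I1 I2 by auto
    then have "connected (?S \<inter> ?T)" using assms(3) by (simp add: arc_imp_path connected_path_image)
    then have "connected_component (- (?S \<union> ?T)) z w"
      using comp cc zout wS compact_imp_closed by (intro Janiszewski[of ?S ?T]) blast+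
    then have "connected_component (- ?G) z w"
      by (rule connected_component_of_subset) auto
    then have "w \<in> inside ?G" using z inside_same_component by blast
    then show False using wS inside_Int_outside by blast
  qed
  then show ?thesis
  proof
    assume "z \<in> inside ?S"
    moreover have "inside ?G \<inter> ?S = {}" using out inside_no_overlap[of ?G] by blast
    ultimately have "inside ?G \<subseteq> inside ?S" using J z by (intro connected_subset_inside) auto
    then show ?thesis ..
  next
    assume "z \<in> inside ?T"
    moreover have "inside ?G \<inter> ?T = {}" using out inside_no_overlap[of ?G] by blast
    ultimately have "inside ?G \<subseteq> inside ?T" using J z by (intro connected_subset_inside) auto
    then show ?thesis ..
  qed
qed

text \<open>By the Jordan curve theorem each point of the second arc is a limit of points of
  \<open>inside (path_image g1 \<union> path_image g2)\<close>. Away from \<open>S\<close>, a small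
  ball around it avoids \<open>S\<close> and meets \<open>inside S\<close>, so it lies in
  \<open>inside S\<close>.\<close>

lemma inside_subset_curve:
  fixes g1 g2 g :: "real \<Rightarrow> complex"
  assumes "arc g1" "arc g2"
    and "pathstart g1 = a" "pathfinish g1 = b" "pathstart g2 = a" "pathfinish g2 = b"
    and I12: "path_image g1 \<inter> path_image g2 = {a, b}"
    and S: "closed S" "S \<inter> path_image g2 = {a, b}"
    and sub: "inside (path_image g1 \<union> path_image g2) \<subseteq> inside S"
  shows "path_image g2 - {a, b} \<subseteq> inside S"
proof
  let ?G = "path_image g1 \<union> path_image g2"
  note J = Jordan_inside_outside[OF arcs_loop(1,3)[OF assms(1-6) I12], unfolded arcs_loop(2)[OF assms(1-6) I12]]
  fix q assume q: "q \<in> path_image g2 - {a, b}"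
  then have "q \<in> closure (inside ?G)" using J by (auto simp: frontier_def)
  moreover have "q \<in> - S" "open (- S)" using q S by auto
  ultimately obtain e where e: "e > 0" "ball q e \<subseteq> - S" by (meson open_contains_ball)
  then obtain z where z: "z \<in> inside ?G" "z \<in> ball q e"
    using \<open>q \<in> closure (inside ?G)\<close> by (auto simp: closure_approachable dist_commute)
  have "ball q e \<subseteq> inside S"
    using e z sub by (intro connected_subset_inside) auto
  then show "q \<in> inside S" using e by auto
qed

section \<open>Paths and cycles in graphs\<close>

fun pedges :: "'a list \<Rightarrow> 'a set set" where
  "pedges [] = {}"
| "pedges [x] = {}"
| "pedges (x # y # xs) = insert {x, y} (pedges (y # xs))"

definition cedges :: "'a list \<Rightarrow> 'a set set" where
  "cedges vs = pedges (vs @ [hd vs])"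

lemma finite_pedges: "finite (pedges xs)"
  by (induction xs rule: pedges.induct) auto

lemma pedges_append:
  "pedges (xs @ ys) = pedges xs \<union> pedges ys \<union> (if xs = [] \<or> ys = [] then {} else {{last xs, hd ys}})"
proof (induction xs rule: pedges.induct)
  case (2 x) then show ?case by (cases ys) auto
qed auto

lemma pedges_rev: "pedges (rev xs) = pedges xs"
proof (induction xs rule: pedges.induct)
  case (3 x y xs)
  have "pedges (rev (y # xs) @ [x]) = pedges (rev (y # xs)) \<union> {{y, x}}"
    by (subst pedges_append) simp
  moreover have "{y, x} = {x, y}" by auto
  ultimately show ?case using 3 by simp
qed auto

lemma pedges_subset_set: "e \<in> pedges xs \<Longrightarrow> e \<subseteq> set xs"
  by (induction xs rule: pedges.induct) auto

lemma set_subset_pedges: "2 \<le> length xs \<Longrightarrow> set xs \<subseteq> \<Union> (pedges xs)"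
proof (induction xs rule: pedges.induct)
  case (3 x y xs) then show ?case by (cases xs) auto
qed auto

lemma Union_pedges: "2 \<le> length xs \<Longrightarrow> \<Union> (pedges xs) = set xs"
  using set_subset_pedges pedges_subset_set by blast

lemma card_pedges: "card (pedges xs) \<le> length xs - 1"
proof (induction xs rule: pedges.induct)
  case (3 x y xs)
  then show ?case using card_insert_le_m1[of "length (y # xs)" "pedges (y # xs)" "{x,y}"]
    by (simp add: card_insert_if finite_pedges)
qed auto

lemma successively_edge_iff: "successively (\<lambda>u v. {u, v} \<in> E) xs \<longleftrightarrow> pedges xs \<subseteq> E"
  by (induction xs rule: pedges.induct) auto

lemma is_cycle_iff: "is_cycle E vs \<longleftrightarrow> 3 \<le> length vs \<and> distinct vs \<and> cedges vs \<subseteq> E"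
  by (cases "vs = []") (auto simp: is_cycle_def cedges_def pedges_append successively_edge_iff)

lemma cedges_append_commute: "xs \<noteq> [] \<Longrightarrow> ys \<noteq> [] \<Longrightarrow> cedges (xs @ ys) = cedges (ys @ xs)"
  unfolding cedges_def by (auto simp: pedges_append)

lemma cedges_split: "cedges (a # xs @ b # ys) = pedges (a # xs @ [b]) \<union> pedges (a # rev ys @ [b])"
proof -
  have "pedges (a # rev ys @ [b]) = pedges (b # ys @ [a])"
    using pedges_rev[of "b # ys @ [a]"] by simp
  moreover have "pedges ((a # xs) @ b # ys @ [a]) = pedges (a # xs @ [b]) \<union> pedges (b # ys @ [a])"
    using pedges_append[of "a # xs" "b # ys @ [a]"] pedges_append[of "a # xs" "[b]"] by auto
  ultimately show ?thesis by (simp add: cedges_def)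
qed

lemma Union_cedges: "2 \<le> length vs \<Longrightarrow> \<Union> (cedges vs) = set vs"
  unfolding cedges_def by (subst Union_pedges) (auto intro: hd_in_set)

text \<open>The cycle is rotated to start at \<open>a\<close> and cut at \<open>b\<close>. The
  second side is stored in reverse, so that \<open>a # xs @ [b]\<close> and
  \<open>a # ys @ [b]\<close> both run from \<open>a\<close> to \<open>b\<close>.\<close>

lemma cycle_two_paths:
  assumes "is_cycle E vs" "a \<in> set vs" "b \<in> set vs" "a \<noteq> b"
  obtains xs ys where "is_cycle E (a # xs @ b # rev ys)" "cedges (a # xs @ b # rev ys) = cedges vs"
    "set (a # xs @ b # rev ys) = set vs" "length (a # xs @ b # rev ys) = length vs"
proof -
  obtain us ws where vs: "vs = us @ a # ws" using split_list[OF assms(2)] by blast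
  let ?vs = "a # ws @ us"
  have eq: "cedges ?vs = cedges vs"
    using vs cedges_append_commute[of us "a # ws"] by (cases "us = []") auto
  have "b \<in> set (ws @ us)" using assms vs by auto
  then obtain xs zs where "ws @ us = xs @ b # zs" using split_list[of b "ws @ us"] by blast
  then have 1: "?vs = a # xs @ b # rev (rev zs)" by simp
  show ?thesis
  proof (rule that[of xs "rev zs"])
    show "is_cycle E (a # xs @ b # rev (rev zs))"
      using assms(1) eq unfolding 1[symmetric] is_cycle_iff by (auto simp: vs)
    show "set (a # xs @ b # rev (rev zs)) = set vs" "length (a # xs @ b # rev (rev zs)) = length vs"
      unfolding 1[symmetric] by (auto simp: vs)
  qed (use eq 1 in simp)
qed

lemma direct_edge_in_pedges:
  assumes "distinct (a # xs @ [b])" "{a, b} \<in> pedges (a # xs @ [b])" shows "xs = []"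
proof (rule ccontr)
  assume "xs \<noteq> []"
  then obtain x ys where xs: "xs = x # ys" by (cases xs) auto
  have "{a,b} \<noteq> {a,x}" using assms(1) xs by (auto simp: doubleton_eq_iff)
  then have "{a,b} \<in> pedges (x # ys @ [b])" using assms(2) xs by simp
  then show False using pedges_subset_set[of "{a,b}" "x # ys @ [b]"] assms(1) xs by auto
qed

text \<open>When the vertex to be put in front already occurs on the path, the path is shortened to
  start at that occurrence.\<close>

lemma rtrancl_distinct_path:
  assumes "(x, y) \<in> R\<^sup>*"
  shows "\<exists>zs. zs \<noteq> [] \<and> hd zs = x \<and> last zs = y \<and> distinct zs \<and> successively (\<lambda>u v. (u, v) \<in> R) zs"
  using assms
proof (induction rule: converse_rtrancl_induct)
  case base then show ?case by (intro exI[of _ "[y]"]) auto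
next
  case (step x x')
  then obtain zs where zs: "zs \<noteq> []" "hd zs = x'" "last zs = y" "distinct zs" "successively (\<lambda>u v. (u, v) \<in> R) zs"
    by auto
  show ?case
  proof (cases "x \<in> set zs")
    case True
    then obtain us ws where "zs = us @ x # ws" using split_list[of x zs] by blast
    then show ?thesis using zs by (intro exI[of _ "x # ws"]) (auto simp: successively_append_iff)
  next
    case False
    then show ?thesis using zs step by (intro exI[of _ "x # zs"]) (auto simp: successively_Cons)
  qed
qed

text \<open>All neighbors of the first vertex of a longest path lie on that path, and one of them
  other than the second vertex closes a cycle.\<close>

lemma min_degree_2_cycle:
  assumes "finite W" "W \<noteq> {}" "simple_graph W F"
    and deg: "\<And>v. v \<in> W \<Longrightarrow> 2 \<le> card {u. {u, v} \<in> F}"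
  shows "\<exists>vs. is_cycle F vs"
proof -
  define P where "P xs \<longleftrightarrow> xs \<noteq> [] \<and> distinct xs \<and> set xs \<subseteq> W \<and> pedges xs \<subseteq> F" for xs
  have len: "length xs \<le> card W" if "P xs" for xs
    using that assms(1) card_mono[of W "set xs"] by (auto simp: P_def distinct_card)
  obtain w where "w \<in> W" using assms(2) by auto
  then have "P [w]" by (simp add: P_def)
  then obtain xs where xs: "P xs" "\<And>ys. P ys \<Longrightarrow> length ys \<le> length xs"
    using len ex_has_greatest_nat[of P "[w]" length "Suc (card W)"] by (auto simp: less_Suc_eq_le)
  obtain x rest where x: "xs = x # rest" using xs(1) by (cases xs) (auto simp: P_def)
  have xW: "x \<in> W" using xs(1) x by (simp add: P_def)
  have nb: "u \<in> set rest" if "{u, x} \<in> F" for u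
  proof (rule ccontr)
    assume "u \<notin> set rest"
    moreover have "u \<in> W" "u \<noteq> x" using that assms(3) by (auto simp: simple_graph_def)
    ultimately have "P (u # xs)" using xs(1) that x by (auto simp: P_def)
    then show False using xs(2) by fastforce
  qed
  have "\<not> {u. {u, x} \<in> F} \<subseteq> {hd rest}"
    using deg[OF xW] card_mono[of "{hd rest}" "{u. {u, x} \<in> F}"] by auto
  then obtain u where u: "{u, x} \<in> F" "u \<noteq> hd rest" by auto
  then obtain us ws where rest: "rest = us @ u # ws" using nb split_list[of u rest] by blast
  then have "us \<noteq> []" using u by auto
  moreover have "pedges xs = pedges (x # us @ [u]) \<union> pedges (u # ws)"
    using pedges_append[of "x # us" "u # ws"] pedges_append[of "x # us" "[u]"] by (auto simp: x rest)
  moreover have "cedges (x # us @ [u]) = insert {u, x} (pedges (x # us @ [u]))"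
    unfolding cedges_def by (subst pedges_append) auto
  ultimately have "is_cycle F (x # us @ [u])"
    using xs(1) u(1) x rest unfolding is_cycle_iff P_def by (cases us) auto
  then show ?thesis by blast
qed

section \<open>Sparsity of plane graphs of large girth\<close>

locale plane_graph =
  fixes W :: "'a set" and F :: "'a set set" and p :: "'a \<Rightarrow> complex" and \<gamma> :: "'a set \<Rightarrow> real \<Rightarrow> complex"
  assumes finW: "finite W" and sg: "simple_graph W F" and drawing: "planar_drawing W F p \<gamma>"
begin

definition img :: "'a set set \<Rightarrow> complex set" where
  "img A = (\<Union>e\<in>A. path_image (\<gamma> e))"

definition opn :: "'a set \<Rightarrow> complex set" where
  "opn e = path_image (\<gamma> e) - p ` e"

text \<open>Edges are located by their open arcs, since the ends of an edge inside may lie on the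
  curve itself.\<close>

definition Ein :: "'a set set \<Rightarrow> 'a set set" where
  "Ein A = {e\<in>F. opn e \<subseteq> inside (img A)}"

definition Vin :: "'a set set \<Rightarrow> 'a set" where
  "Vin A = {w\<in>W. p w \<in> inside (img A)}"

definition ear :: "'a list \<Rightarrow> 'a \<Rightarrow> 'a \<Rightarrow> 'a list \<Rightarrow> bool" where
  "ear vs a b zs \<longleftrightarrow> a \<in> set vs \<and> b \<in> set vs \<and> a \<noteq> b \<and> distinct zs \<and> set zs \<inter> set vs = {} \<and>
     pedges (a # zs @ [b]) \<subseteq> F \<and> pedges (a # zs @ [b]) \<inter> cedges vs = {}"

text \<open>This says that the graph is connected and has no cut vertex: a cover by two proper parts
  without edges between their differences must overlap in at least two vertices.\<close>

definition nonseparable :: bool where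
  "nonseparable \<longleftrightarrow> (\<forall>X Y. X \<union> Y = W \<longrightarrow> X \<noteq> W \<longrightarrow> Y \<noteq> W \<longrightarrow>
     (\<forall>e\<in>F. e \<subseteq> X \<or> e \<subseteq> Y) \<longrightarrow> 2 \<le> card (X \<inter> Y))"

lemma edge_subset: "e \<in> F \<Longrightarrow> e \<subseteq> W"
  using sg by (auto simp: simple_graph_def)

lemma finF: "finite F"
  using finW edge_subset by (intro finite_subset[of F "Pow W"]) auto

lemma arc_edge: "e \<in> F \<Longrightarrow> arc (\<gamma> e)"
  and ends_edge: "e \<in> F \<Longrightarrow> {pathstart (\<gamma> e), pathfinish (\<gamma> e)} = p ` e"
  and edge_vertices: "e \<in> F \<Longrightarrow> path_image (\<gamma> e) \<inter> p ` W \<subseteq> p ` e"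
  and edges_meet: "e \<in> F \<Longrightarrow> f \<in> F \<Longrightarrow> e \<noteq> f \<Longrightarrow> path_image (\<gamma> e) \<inter> path_image (\<gamma> f) \<subseteq> p ` (e \<inter> f)"
  and p_inj: "inj_on p W"
  using drawing unfolding planar_drawing_def by auto

lemma ends_in_edge: "e \<in> F \<Longrightarrow> p ` e \<subseteq> path_image (\<gamma> e)"
  by (subst ends_edge[symmetric]) auto

lemma vertex_in_edge: "e \<in> F \<Longrightarrow> w \<in> W \<Longrightarrow> p w \<in> path_image (\<gamma> e) \<Longrightarrow> w \<in> e"
  using edge_vertices[of e] edge_subset[of e] inj_on_image_mem_iff[OF p_inj, of w e] by blast

lemma vertex_in_img:
  assumes "A \<subseteq> F" "w \<in> W" shows "p w \<in> img A \<longleftrightarrow> w \<in> \<Union>A"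
  using assms vertex_in_edge[of _ w] ends_in_edge by (fastforce simp: img_def)

lemma img_meet:
  assumes "A \<subseteq> F" "B \<subseteq> F" "A \<inter> B = {}" shows "img A \<inter> img B \<subseteq> p ` (\<Union>A \<inter> \<Union>B)"
proof
  fix z assume "z \<in> img A \<inter> img B"
  then obtain e f where "e \<in> A" "f \<in> B" "z \<in> path_image (\<gamma> e) \<inter> path_image (\<gamma> f)" by (auto simp: img_def)
  then show "z \<in> p ` (\<Union>A \<inter> \<Union>B)" using edges_meet[of e f] assms by fastforce
qed

lemma img_Un: "img (A \<union> B) = img A \<union> img B"
  by (auto simp: img_def)

lemma connected_opn:
  assumes "e \<in> F" "X \<subseteq> e" shows "connected (opn e \<union> p ` X)"
  unfolding opn_def ends_edge[OF assms(1), symmetric]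
  by (rule connected_arc_with_ends) (use assms arc_edge ends_edge[OF assms(1)] in auto)

lemma connected_opn': "e \<in> F \<Longrightarrow> connected (opn e)"
  using connected_opn[of e "{}"] by simp

lemma opn_nonempty: assumes "e \<in> F" shows "opn e \<noteq> {}"
  unfolding opn_def ends_edge[OF assms, symmetric]
  by (rule nonempty_simple_path_endless) (use arc_imp_simple_path arc_edge assms in blast)

lemma opn_disjoint_img: assumes "A \<subseteq> F" "e \<in> F - A" shows "opn e \<inter> img A = {}"
  using img_meet[of "{e}" A] assms by (auto simp: opn_def img_def)

lemma opn_subset_img: "e \<in> A \<Longrightarrow> opn e \<subseteq> img A"
  by (auto simp: opn_def img_def)

lemma opn_vertex: "e \<in> F \<Longrightarrow> w \<in> W \<Longrightarrow> p w \<notin> opn e"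
  using vertex_in_edge[of e w] by (auto simp: opn_def)

lemma Ein_disjoint: "A \<inter> Ein A = {}"
proof (rule ccontr)
  assume "A \<inter> Ein A \<noteq> {}"
  then obtain e where e: "e \<in> A" "e \<in> F" "opn e \<subseteq> inside (img A)" by (auto simp: Ein_def)
  then show False
    using opn_subset_img[OF e(1)] opn_nonempty[OF e(2)] inside_no_overlap[of "img A"] by blast
qed

lemma compact_img: "A \<subseteq> F \<Longrightarrow> compact (img A)"
  unfolding img_def using finite_subset[OF _ finF] arc_edge
  by (intro compact_UN) (auto intro: compact_arc_image)

lemma finite_Ein: "finite (Ein A)" and finite_Vin: "finite (Vin A)"
  using finF finW by (auto simp: Ein_def Vin_def)

lemma path_arc:
  assumes "pedges xs \<subseteq> F" "distinct xs" "2 \<le> length xs"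
  shows "\<exists>g. arc g \<and> pathstart g = p (hd xs) \<and> pathfinish g = p (last xs) \<and> path_image g = img (pedges xs)"
  using assms
proof (induction xs rule: pedges.induct)
  case (3 x y xs)
  have exy: "{x, y} \<in> F" and ne: "x \<noteq> y" using 3 by auto
  obtain g1 where g1: "arc g1" "pathstart g1 = p x" "pathfinish g1 = p y" "path_image g1 = path_image (\<gamma> {x,y})"
  proof -
    have *: "{pathstart (\<gamma> {x,y}), pathfinish (\<gamma> {x,y})} = {p x, p y}" using ends_edge[OF exy] by simp
    show ?thesis
    proof (cases "pathstart (\<gamma> {x,y}) = p x")
      case True
      moreover have "pathfinish (\<gamma> {x,y}) = p y"
        using * True arc_distinct_ends[OF arc_edge[OF exy]] by (auto simp: doubleton_eq_iff)
      ultimately show ?thesis using that arc_edge[OF exy] by blast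
    next
      case False
      then have "pathstart (\<gamma> {x,y}) = p y" "pathfinish (\<gamma> {x,y}) = p x"
        using * by (auto simp: doubleton_eq_iff)
      then show ?thesis using that[of "reversepath (\<gamma> {x,y})"] arc_edge[OF exy] by (simp add: arc_reversepath)
    qed
  qed
  show ?case
  proof (cases xs)
    case Nil
    then show ?thesis using g1 by (intro exI[of _ g1]) (simp add: img_def)
  next
    case (Cons z zs)
    then obtain g2 where g2: "arc g2" "pathstart g2 = p y" "pathfinish g2 = p (last (y # xs))"
      "path_image g2 = img (pedges (y # xs))" using 3 by auto
    have notin: "{x,y} \<notin> pedges (y # xs)" using pedges_subset_set[of "{x,y}" "y # xs"] 3(3) by auto
    have "path_image g1 \<inter> path_image g2 \<subseteq> p ` (\<Union>{{x,y}} \<inter> \<Union>(pedges (y # xs)))"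
      using img_meet[of "{{x,y}}" "pedges (y # xs)"] 3(2) exy notin g1 g2 by (auto simp: img_def)
    also have "\<Union>{{x,y}} \<inter> \<Union>(pedges (y # xs)) \<subseteq> {y}"
      using pedges_subset_set[of _ "y # xs"] 3(3) by fastforce
    finally have "path_image g1 \<inter> path_image g2 \<subseteq> {pathstart g2}" using g2 by auto
    then have "arc (g1 +++ g2)" using g1 g2 by (intro arc_join) auto
    then show ?thesis using g1 g2
      by (intro exI[of _ "g1 +++ g2"]) (auto simp: path_image_join img_def)
  qed
qed auto

section \<open>Ears and theta subgraphs\<close>

text \<open>The region \<open>I\<close> will be the inside or the outside of the cycle. If the given
  edge is not itself a chord, it has an end \<open>x\<close> off the cycle. The component
  \<open>K\<close> of \<open>x\<close> off the cycle stays in \<open>I\<close>, nonseparability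
  attaches it to at least two vertices of the cycle, and a path through \<open>K\<close> joining two
  of these is the ear.\<close>

lemma ear_exists:
  assumes ns: nonseparable and cyc: "is_cycle F vs" and e: "e \<in> F" "e \<notin> cedges vs" "opn e \<subseteq> I"
    and sat: "\<And>S. connected S \<Longrightarrow> S \<inter> img (cedges vs) = {} \<Longrightarrow> S \<inter> I \<noteq> {} \<Longrightarrow> S \<subseteq> I"
  obtains a b zs f where "ear vs a b zs" "f \<in> pedges (a # zs @ [b])" "opn f \<subseteq> I"
proof -
  have cF: "cedges vs \<subseteq> F" and len: "3 \<le> length vs" and dist: "distinct vs" using cyc by (auto simp: is_cycle_iff)
  have Uc: "\<Union>(cedges vs) = set vs" using len by (intro Union_cedges) auto
  have vsW: "set vs \<subseteq> W" using Uc cF edge_subset by blast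
  have side: "opn f \<subseteq> I \<and> p ` (f - set vs) \<subseteq> I"
    if f: "f \<in> F" "f \<notin> cedges vs" "(opn f \<union> p ` (f - set vs)) \<inter> I \<noteq> {}" for f
  proof -
    have "p ` (f - set vs) \<inter> img (cedges vs) = {}"
      using vertex_in_img[OF cF] Uc edge_subset[OF f(1)] by auto
    then have "opn f \<union> p ` (f - set vs) \<subseteq> I"
      using f opn_disjoint_img[OF cF, of f] connected_opn[of f "f - set vs"] by (intro sat) auto
    then show ?thesis by auto
  qed
  have notc: "f \<notin> cedges vs" if "x \<in> f" "x \<notin> set vs" for f x using Uc that by auto
  show ?thesis
  proof (cases "e \<subseteq> set vs")
    case True
    obtain a b where ab: "e = {a, b}" "a \<noteq> b" using e(1) sg by (auto simp: simple_graph_def card_2_iff)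
    then have "ear vs a b []" using True e by (auto simp: ear_def)
    then show ?thesis using that[of a b "[]" e] ab e by auto
  next
    case False
    then obtain x where x: "x \<in> e" "x \<notin> set vs" by auto
    define R where "R = {(u, w). {u, w} \<in> F \<and> u \<notin> set vs \<and> w \<notin> set vs}"
    define K where "K = R\<^sup>* `` {x}"
    define N where "N = {c\<in>set vs. \<exists>y\<in>K. {y, c} \<in> F}"
    have xK: "x \<in> K" by (simp add: K_def)
    have pxI: "p x \<in> I" using side[of e] e x opn_nonempty[OF e(1)] notc by auto
    have K: "y \<notin> set vs \<and> y \<in> W \<and> p y \<in> I" if "y \<in> K" for y
    proof -
      have "(x, y) \<in> R\<^sup>*" using that by (simp add: K_def)
      then show ?thesis
      proof (induction rule: rtrancl_induct)
        case base then show ?case using x pxI e edge_subset by auto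
      next
        case (step y z)
        then have yz: "{y, z} \<in> F" "y \<notin> set vs" "z \<notin> set vs" by (auto simp: R_def)
        then have "p ` ({y,z} - set vs) \<subseteq> I" using side[of "{y,z}"] step notc[of y "{y,z}"] by auto
        then show ?case using yz edge_subset[OF yz(1)] by auto
      qed
    qed
    have closedK: "w \<in> K \<or> w \<in> N" if "y \<in> K" "{y, w} \<in> F" for y w
    proof (cases "w \<in> set vs")
      case True then show ?thesis using that by (auto simp: N_def)
    next
      case False
      then have "(y, w) \<in> R" using that K by (auto simp: R_def)
      then show ?thesis using that(1) by (auto simp: K_def intro: rtrancl_into_rtrancl)
    qed
    \<comment> \<open>The sets \<open>K \<union> N\<close> and \<open>W - K\<close> contain every
      edge and meet exactly in \<open>N\<close>. Both are proper, the first because it misses a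
      vertex of the cycle when \<open>N\<close> has at most one element.\<close>
    have "\<not> card N \<le> 1"
    proof
      assume N1: "card N \<le> 1"
      have NW: "N \<subseteq> set vs" by (auto simp: N_def)
      have "K \<union> N \<noteq> W"
      proof
        assume "K \<union> N = W"
        then have "set vs \<subseteq> N" using K vsW by blast
        then have "3 \<le> card N" using len distinct_card[OF dist] card_mono[of N "set vs"] NW finite_subset by fastforce
        then show False using N1 by simp
      qed
      moreover have "W - K \<noteq> W" using xK K by blast
      moreover have "K \<union> N \<union> (W - K) = W" using K NW vsW by blast
      moreover have "f \<subseteq> K \<union> N \<or> f \<subseteq> W - K" if f: "f \<in> F" for f
      proof -
        obtain u w where "f = {u, w}" using f sg by (auto simp: simple_graph_def card_2_iff)
        then show ?thesis using closedK[of u w] closedK[of w u] f edge_subset[OF f] by (auto simp: insert_commute)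
      qed
      ultimately have "2 \<le> card ((K \<union> N) \<inter> (W - K))" using ns unfolding nonseparable_def by blast
      moreover have "(K \<union> N) \<inter> (W - K) = N" using K NW vsW by blast
      ultimately show False using N1 by simp
    qed
    moreover have "finite N" by (simp add: N_def)
    ultimately have "\<exists>a\<in>N. \<exists>b\<in>N. a \<noteq> b" using card_le_Suc0_iff_eq[of N] by auto
    then obtain a b where ab: "a \<in> N" "b \<in> N" "a \<noteq> b" by blast
    then obtain y1 y2 where y: "y1 \<in> K" "{y1, a} \<in> F" "y2 \<in> K" "{y2, b} \<in> F" by (auto simp: N_def)
    have "sym R" by (auto simp: R_def sym_def insert_commute)
    then have "(y1, y2) \<in> R\<^sup>*" using y by (auto simp: K_def intro: rtrancl_trans dest: symD[OF sym_rtrancl])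
    then obtain zs where zs: "zs \<noteq> []" "hd zs = y1" "last zs = y2" "distinct zs" "successively (\<lambda>u v. (u, v) \<in> R) zs"
      using rtrancl_distinct_path by metis
    have 1: "pedges zs \<subseteq> F"
      using zs(5) unfolding successively_edge_iff[symmetric] by (rule successively_mono) (auto simp: R_def)
    have 2: "set zs \<inter> set vs = {}"
    proof (cases "length zs = 1")
      case True
      then show ?thesis using zs(1,2) y K by (cases zs) auto
    next
      case False
      then have "2 \<le> length zs" using zs(1) by (cases "length zs") auto
      moreover have "e \<inter> set vs = {}" if "e \<in> pedges zs" for e
        using zs(5) that by (induction zs rule: pedges.induct) (auto simp: R_def)
      ultimately show ?thesis using set_subset_pedges[of zs] by blast
    qed
    have edges: "pedges (a # zs @ [b]) = insert {a, y1} (insert {y2, b} (pedges zs))"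
    proof -
      have "pedges ([a] @ zs) = insert {a, y1} (pedges zs)" using zs(1,2) by (subst pedges_append) auto
      moreover have "pedges (([a] @ zs) @ [b]) = insert {y2, b} (pedges ([a] @ zs))"
        using zs(1,3) by (subst pedges_append) auto
      ultimately show ?thesis by auto
    qed
    have "ear vs a b zs"
      unfolding ear_def
    proof (intro conjI)
      show "pedges (a # zs @ [b]) \<subseteq> F" using edges 1 y by (simp add: insert_commute)
      have "\<exists>z\<in>set zs. z \<in> f" if "f \<in> pedges (a # zs @ [b])" for f
      proof -
        have "f \<noteq> {}" if "f \<in> pedges zs" for f using that by (induction zs rule: pedges.induct) auto
        then show ?thesis using that edges pedges_subset_set[of f zs] zs(1-3) by force
      qed
      then show "pedges (a # zs @ [b]) \<inter> cedges vs = {}" using 2 notc by blast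
    qed (use ab zs 2 in \<open>auto simp: N_def\<close>)
    moreover have "opn {a, y1} \<subseteq> I"
      using side[of "{a, y1}"] K[OF y(1)] notc[of y1 "{a,y1}"] y(2) by (auto simp: insert_commute)
    ultimately show ?thesis using that[of a b zs "{a, y1}"] edges by auto
  qed
qed

text \<open>A cycle and an ear form a theta: three paths from \<open>a\<close> to \<open>b\<close>
  with no common inner vertices, where the ear closes to a cycle with either side. The combinatorial
  and topological facts are collected here for ears on both sides of the curve.\<close>

lemma theta:
  assumes cyc: "is_cycle F vs" and ear: "ear vs a b zs"
  obtains xs ys P1 P2 P g1 g2 g where
    "P = pedges (a # zs @ [b])" "cedges vs = P1 \<union> P2" "P1 \<inter> P2 = {}" "P \<inter> cedges vs = {}" "P \<subseteq> F" "P2 \<noteq> {}"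
    "is_cycle F (a # xs @ b # rev zs)" "cedges (a # xs @ b # rev zs) = P1 \<union> P"
    "is_cycle F (a # ys @ b # rev zs)" "cedges (a # ys @ b # rev zs) = P2 \<union> P"
    "length vs = length xs + length ys + 2"
    "arc g1" "pathstart g1 = p a" "pathfinish g1 = p b" "path_image g1 = img P1"
    "arc g2" "pathstart g2 = p a" "pathfinish g2 = p b" "path_image g2 = img P2"
    "arc g" "pathstart g = p a" "pathfinish g = p b" "path_image g = img P"
    "img P1 \<inter> img P2 = {p a, p b}" "img P1 \<inter> img P = {p a, p b}" "img P2 \<inter> img P = {p a, p b}"
proof -
  have e: "a \<in> set vs" "b \<in> set vs" "a \<noteq> b" "distinct zs" "set zs \<inter> set vs = {}"
    "pedges (a # zs @ [b]) \<subseteq> F" "pedges (a # zs @ [b]) \<inter> cedges vs = {}"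
    using ear by (auto simp: ear_def)
  obtain xs ys where c: "is_cycle F (a # xs @ b # rev ys)" "cedges (a # xs @ b # rev ys) = cedges vs"
    "set (a # xs @ b # rev ys) = set vs" "length (a # xs @ b # rev ys) = length vs"
    using cycle_two_paths[OF cyc e(1-3)] by blast
  let ?P1 = "pedges (a # xs @ [b])" and ?P2 = "pedges (a # ys @ [b])" and ?P = "pedges (a # zs @ [b])"
  have C: "cedges vs = ?P1 \<union> ?P2" using c(2) cedges_split[of a xs b "rev ys"] by simp
  have sub: "?P1 \<subseteq> F" "?P2 \<subseteq> F" using c(1,2) C by (auto simp: is_cycle_iff)
  have d: "distinct (a # xs @ [b])" "distinct (a # ys @ [b])" "distinct (a # zs @ [b])" "set xs \<inter> set ys = {}"
    using c(1,3) e by (auto simp: is_cycle_iff)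
  have zs: "set zs \<inter> (set xs \<union> set ys \<union> {a, b}) = {}" using c(3) e(5) by auto
  have len: "length vs = length xs + length ys + 2" using c(4) by simp
  have len3: "3 \<le> length vs" using cyc by (simp add: is_cycle_iff)
  \<comment> \<open>A common edge could only be \<open>{a, b}\<close>; then both sides would be that
    edge, and the cycle would have length 2.\<close>
  have disj: "?P1 \<inter> ?P2 = {}"
  proof (rule ccontr)
    assume "?P1 \<inter> ?P2 \<noteq> {}"
    then obtain f where f: "f \<in> ?P1" "f \<in> ?P2" by blast
    have "f \<subseteq> {a, b}"
      using pedges_subset_set[OF f(1)] pedges_subset_set[OF f(2)] d(4) by auto
    moreover have "card f = 2" using f sub sg by (auto simp: simple_graph_def)
    ultimately have "f = {a, b}" using e(3) by (metis card_2_iff card_seteq card.empty finite.emptyI finite_insert order_refl card_subset_eq)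
    then have "xs = []" "ys = []" using direct_edge_in_pedges d(1,2) f by metis+
    then show False using len len3 by simp
  qed
  have U: "\<Union>?P1 = {a, b} \<union> set xs" "\<Union>?P2 = {a, b} \<union> set ys" "\<Union>?P = {a, b} \<union> set zs"
    by (subst Union_pedges; auto)+
  have abW: "a \<in> W" "b \<in> W" using U(1) sub(1) edge_subset by blast+
  have meet: "img A \<inter> img B = {p a, p b}"
    if "A \<subseteq> F" "B \<subseteq> F" "A \<inter> B = {}" "\<Union>A \<inter> \<Union>B = {a, b}" for A B
  proof
    show "img A \<inter> img B \<subseteq> {p a, p b}" using img_meet[OF that(1-3)] that(4) by auto
    have "a \<in> \<Union>A" "a \<in> \<Union>B" "b \<in> \<Union>A" "b \<in> \<Union>B" using that(4) by auto
    then show "{p a, p b} \<subseteq> img A \<inter> img B"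
      using vertex_in_img[OF that(1)] vertex_in_img[OF that(2)] abW by simp
  qed
  \<comment> \<open>An ear without inner vertices is a chord and not an edge of the cycle, so
    neither side can be a direct edge then. This gives both new cycles length at least 3.\<close>
  have nonempty: "xs \<noteq> [] \<or> zs \<noteq> []" "ys \<noteq> [] \<or> zs \<noteq> []" using e(7) C by auto
  have c1: "cedges (a # xs @ b # rev zs) = ?P1 \<union> ?P" "cedges (a # ys @ b # rev zs) = ?P2 \<union> ?P"
    using cedges_split[of a xs b "rev zs"] cedges_split[of a ys b "rev zs"] by auto
  have cyc1: "is_cycle F (a # xs @ b # rev zs)"
    unfolding is_cycle_iff c1 using d(1,3) zs nonempty(1) sub e(6)
    by (cases xs; cases zs) auto
  have cyc2: "is_cycle F (a # ys @ b # rev zs)"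
    unfolding is_cycle_iff c1 using d(2,3) zs nonempty(2) sub e(6)
    by (cases ys; cases zs) auto
  obtain g1 where "arc g1" "pathstart g1 = p a" "pathfinish g1 = p b" "path_image g1 = img ?P1"
    using path_arc[OF sub(1) d(1)] by auto
  moreover obtain g2 where "arc g2" "pathstart g2 = p a" "pathfinish g2 = p b" "path_image g2 = img ?P2"
    using path_arc[OF sub(2) d(2)] by auto
  moreover obtain g where "arc g" "pathstart g = p a" "pathfinish g = p b" "path_image g = img ?P"
    using path_arc[OF e(6) d(3)] by auto
  moreover have "img ?P1 \<inter> img ?P2 = {p a, p b}" by (rule meet) (use sub disj U d(4) in auto)
  moreover have "img ?P1 \<inter> img ?P = {p a, p b}" by (rule meet) (use sub e(6,7) C U zs in auto)
  moreover have "img ?P2 \<inter> img ?P = {p a, p b}" by (rule meet) (use sub e(6,7) C U zs in auto)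
  moreover have "?P2 \<noteq> {}" using U(2) by auto
  ultimately show ?thesis using that[of ?P ?P1 ?P2 xs ys g1 g2 g] C disj e(6,7) c1 cyc1 cyc2 len by simp
qed

lemma opn_img_minus_ends:
  assumes "f \<in> A" "A \<subseteq> F" "a \<in> W" "b \<in> W" shows "opn f \<subseteq> img A - {p a, p b}"
  using opn_subset_img[OF assms(1)] opn_vertex[of f] assms by blast

section \<open>Counting edges inside a cycle and enlarging it\<close>

text \<open>Induction on the number of edges inside; if there are none, the girth suffices.
  Otherwise an ear with \<open>l\<close> inner vertices splits the inside between two cycles whose
  lengths sum to \<open>length vs + 2 * l + 2\<close>, and contributes \<open>l\<close> vertices and
  at most \<open>l + 1\<close> edges. When their bounds are added,
  \<open>9 * (l + 1) + 11 + (2 * l + 2) - 22 = 11 * l\<close> is just what the inner vertices of the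
  ear pay for.\<close>

lemma inside_bound:
  assumes ns: nonseparable and girth: "\<And>vs. is_cycle F vs \<Longrightarrow> 11 \<le> length vs" and "is_cycle F vs"
  shows "9 * card (Ein (cedges vs)) + 11 \<le> 11 * card (Vin (cedges vs)) + length vs"
  using assms(3)
proof (induction "card (Ein (cedges vs))" arbitrary: vs rule: less_induct)
  case less
  show ?case
  proof (cases "Ein (cedges vs) = {}")
    case True
    then show ?thesis using girth[OF less.prems] by simp
  next
    case False
    let ?C = "cedges vs"
    obtain e where e: "e \<in> F" "opn e \<subseteq> inside (img ?C)" using False by (auto simp: Ein_def)
    then have "e \<notin> ?C" using Ein_disjoint[of ?C] by (auto simp: Ein_def)
    then obtain a b zs f where ear: "ear vs a b zs" and f: "f \<in> pedges (a # zs @ [b])" "opn f \<subseteq> inside (img ?C)"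
      using ear_exists[OF ns less.prems e(1) _ e(2) connected_subset_inside] by blast
    obtain xs ys P1 P2 P g1 g2 g where P: "P = pedges (a # zs @ [b])" "?C = P1 \<union> P2" "P1 \<inter> P2 = {}" "P \<inter> ?C = {}" "P \<subseteq> F"
      "P2 \<noteq> {}"
      and c1: "is_cycle F (a # xs @ b # rev zs)" "cedges (a # xs @ b # rev zs) = P1 \<union> P"
      and c2: "is_cycle F (a # ys @ b # rev zs)" "cedges (a # ys @ b # rev zs) = P2 \<union> P"
      and len: "length vs = length xs + length ys + 2"
      and g1: "arc g1" "pathstart g1 = p a" "pathfinish g1 = p b" "path_image g1 = img P1"
      and g2: "arc g2" "pathstart g2 = p a" "pathfinish g2 = p b" "path_image g2 = img P2"
      and g: "arc g" "pathstart g = p a" "pathfinish g = p b" "path_image g = img P"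
      and I: "img P1 \<inter> img P2 = {p a, p b}" "img P1 \<inter> img P = {p a, p b}" "img P2 \<inter> img P = {p a, p b}"
      by (rule theta[OF less.prems ear])
    have zsd: "distinct zs" "set zs \<inter> {a, b} = {}" "a \<noteq> b" and CF: "?C \<subseteq> F"
      using ear less.prems by (auto simp: ear_def is_cycle_iff)
    have UP: "\<Union>P = {a, b} \<union> set zs" unfolding P(1) by (subst Union_pedges) auto
    have W: "a \<in> W" "b \<in> W" "set zs \<subseteq> W" using UP P(5) edge_subset by blast+
    have pab: "p a \<noteq> p b" using W zsd(3) p_inj by (auto simp: inj_on_def)
    let ?i = "inside (img ?C)" and ?i1 = "inside (img (P1 \<union> P))" and ?i2 = "inside (img (P2 \<union> P))"
    have "img P \<inter> ?i \<noteq> {}"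
      using f opn_nonempty[of f] opn_subset_img[of f P] P(1,5) by blast
    \<comment> \<open>The two smaller insides and the open ear partition the inside of the cycle;
      the edge and vertex counts below follow this partition.\<close>
    then obtain split: "?i1 \<inter> ?i2 = {}" "?i1 \<union> ?i2 \<union> (img P - {p a, p b}) = ?i"
      using split_inside_simple_closed_curve[of g1 "p a" "p b" g2 g] g1 g2 g I pab arc_imp_simple_path P(2)
      by (metis img_Un)
    have PiF: "P1 \<union> P \<subseteq> F" "P2 \<union> P \<subseteq> F" using P CF by auto
    have Edec: "Ein ?C = Ein (P1 \<union> P) \<union> Ein (P2 \<union> P) \<union> P"
    proof (intro equalityI subsetI)
      fix x assume x: "x \<in> Ein ?C"
      show "x \<in> Ein (P1 \<union> P) \<union> Ein (P2 \<union> P) \<union> P"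
      proof (rule ccontr)
        assume n: "x \<notin> Ein (P1 \<union> P) \<union> Ein (P2 \<union> P) \<union> P"
        have xF: "x \<in> F" and xi: "opn x \<subseteq> ?i" using x by (auto simp: Ein_def)
        have "x \<notin> ?C" using x Ein_disjoint[of ?C] by auto
        then have d: "opn x \<inter> img (P1 \<union> P) = {}" "opn x \<inter> img (P2 \<union> P) = {}"
          using n xF P by (intro opn_disjoint_img PiF; auto)+
        then have "opn x \<subseteq> ?i1 \<union> ?i2" using xi split(2) by (auto simp: img_Un)
        then have "opn x \<subseteq> ?i1 \<or> opn x \<subseteq> ?i2"
          using opn_nonempty[OF xF] connected_subset_inside[OF connected_opn'[OF xF] d(1)]
            connected_subset_inside[OF connected_opn'[OF xF] d(2)] by blast
        then show False using n xF by (auto simp: Ein_def)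
      qed
    next
      fix x assume "x \<in> Ein (P1 \<union> P) \<union> Ein (P2 \<union> P) \<union> P"
      moreover have "opn x \<subseteq> img P - {p a, p b}" if "x \<in> P" using opn_img_minus_ends that P(5) W by blast
      ultimately show "x \<in> Ein ?C" using split(2) P(5) by (auto simp: Ein_def)
    qed
    have Edisj: "Ein (P1 \<union> P) \<inter> Ein (P2 \<union> P) = {}" "(Ein (P1 \<union> P) \<union> Ein (P2 \<union> P)) \<inter> P = {}"
    proof -
      show "Ein (P1 \<union> P) \<inter> Ein (P2 \<union> P) = {}"
        using split(1) opn_nonempty by (fastforce simp: Ein_def)
      show "(Ein (P1 \<union> P) \<union> Ein (P2 \<union> P)) \<inter> P = {}"
        using Ein_disjoint[of "P1 \<union> P"] Ein_disjoint[of "P2 \<union> P"] by blast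
    qed
    have Vdec: "Vin ?C = Vin (P1 \<union> P) \<union> Vin (P2 \<union> P) \<union> set zs"
    proof -
      have "w \<in> set zs \<longleftrightarrow> p w \<in> img P - {p a, p b}" if "w \<in> W" for w
        using vertex_in_img[OF P(5) that] UP zsd(2) W that p_inj by (auto simp: inj_on_def)
      then show ?thesis using split(2) W(3) by (auto simp: Vin_def)
    qed
    have Vdisj: "Vin (P1 \<union> P) \<inter> Vin (P2 \<union> P) = {}" "(Vin (P1 \<union> P) \<union> Vin (P2 \<union> P)) \<inter> set zs = {}"
    proof -
      show "Vin (P1 \<union> P) \<inter> Vin (P2 \<union> P) = {}" using split(1) by (auto simp: Vin_def)
      have "p w \<in> img P" if "w \<in> set zs" for w using vertex_in_img[OF P(5)] UP that W by auto
      then show "(Vin (P1 \<union> P) \<union> Vin (P2 \<union> P)) \<inter> set zs = {}"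
        using inside_no_overlap[of "img (P1 \<union> P)"] inside_no_overlap[of "img (P2 \<union> P)"]
        by (fastforce simp: Vin_def img_Un)
    qed
    have finP: "finite P" by (simp add: P(1) finite_pedges)
    have cE: "card (Ein ?C) = card (Ein (P1 \<union> P)) + card (Ein (P2 \<union> P)) + card P"
      unfolding Edec using Edisj finP finite_Ein by (simp add: card_Un_disjoint)
    have cV: "card (Vin ?C) = card (Vin (P1 \<union> P)) + card (Vin (P2 \<union> P)) + length zs"
      unfolding Vdec using Vdisj finite_Vin zsd(1) by (simp add: card_Un_disjoint distinct_card)
    have "card P > 0" using finP f P(1) by (auto simp: card_gt_0_iff)
    then have "card (Ein (P1 \<union> P)) < card (Ein ?C)" "card (Ein (P2 \<union> P)) < card (Ein ?C)" using cE by auto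
    then have "9 * card (Ein (P1 \<union> P)) + 11 \<le> 11 * card (Vin (P1 \<union> P)) + length (a # xs @ b # rev zs)"
      "9 * card (Ein (P2 \<union> P)) + 11 \<le> 11 * card (Vin (P2 \<union> P)) + length (a # ys @ b # rev zs)"
      using less.hyps[of "a # xs @ b # rev zs"] less.hyps[of "a # ys @ b # rev zs"] c1 c2 by simp_all
    moreover have "card P \<le> length zs + 1" using card_pedges[of "a # zs @ [b]"] P(1) by simp
    ultimately show ?thesis using cE cV len by simp
  qed
qed

text \<open>An edge outside leads to an ear outside. One of the two cycles formed with the ear
  encloses the old inside and hence also the side of the old cycle that it leaves out, so the edges
  of that side are gained.\<close>

lemma outside_edge_enlarges:
  assumes ns: nonseparable and cyc: "is_cycle F vs" and e: "e \<in> F" "e \<notin> cedges vs" "e \<notin> Ein (cedges vs)"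
  shows "\<exists>ws. is_cycle F ws \<and> card (Ein (cedges vs)) < card (Ein (cedges ws))"
proof -
  let ?C = "cedges vs"
  have CF: "?C \<subseteq> F" using cyc by (simp add: is_cycle_iff)
  have d: "opn e \<inter> img ?C = {}" using e CF by (intro opn_disjoint_img) auto
  have "opn e \<inter> inside (img ?C) = {}"
    using connected_subset_inside[OF connected_opn'[OF e(1)] d] e by (auto simp: Ein_def)
  then have "opn e \<subseteq> outside (img ?C)" using d inside_Un_outside[of "img ?C"] by blast
  then obtain a b zs f where ear: "ear vs a b zs" and f: "f \<in> pedges (a # zs @ [b])" "opn f \<subseteq> outside (img ?C)"
    using ear_exists[OF ns cyc e(1,2) _ connected_subset_outside] by blast
  obtain xs ys P1 P2 P g1 g2 g where P: "P = pedges (a # zs @ [b])" "?C = P1 \<union> P2" "P1 \<inter> P2 = {}" "P \<inter> ?C = {}" "P \<subseteq> F"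
      "P2 \<noteq> {}"
      and c1: "is_cycle F (a # xs @ b # rev zs)" "cedges (a # xs @ b # rev zs) = P1 \<union> P"
      and c2: "is_cycle F (a # ys @ b # rev zs)" "cedges (a # ys @ b # rev zs) = P2 \<union> P"
      and len: "length vs = length xs + length ys + 2"
      and g1: "arc g1" "pathstart g1 = p a" "pathfinish g1 = p b" "path_image g1 = img P1"
      and g2: "arc g2" "pathstart g2 = p a" "pathfinish g2 = p b" "path_image g2 = img P2"
      and g: "arc g" "pathstart g = p a" "pathfinish g = p b" "path_image g = img P"
      and I: "img P1 \<inter> img P2 = {p a, p b}" "img P1 \<inter> img P = {p a, p b}" "img P2 \<inter> img P = {p a, p b}"
    by (rule theta[OF cyc ear])
  have "\<Union>?C = set vs" using cyc by (intro Union_cedges) (auto simp: is_cycle_iff)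
  then have "set vs \<subseteq> W" using CF edge_subset by blast
  then have abW: "a \<in> W" "b \<in> W" using ear by (auto simp: ear_def)
  have "img P \<inter> inside (img ?C) = {}"
  proof (rule ccontr)
    assume "\<not> ?thesis"
    moreover have PI: "img P \<inter> img ?C = {p a, p b}" using I P(2) by (auto simp: img_Un)
    ultimately have ne: "(img P - {p a, p b}) \<inter> inside (img ?C) \<noteq> {}"
      using inside_no_overlap[of "img ?C"] by blast
    have "connected (img P - {p a, p b})"
      using connected_simple_path_endless[OF arc_imp_simple_path[OF g(1)]] g by simp
    then have "img P - {p a, p b} \<subseteq> inside (img ?C)"
      by (rule connected_subset_inside) (use PI ne in auto)
    moreover have "opn f \<subseteq> img P - {p a, p b}" using opn_img_minus_ends f(1) P(1,5) abW by blast
    ultimately have "opn f \<subseteq> inside (img ?C)" by blast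
    then show False using f(2) opn_nonempty[of f] f(1) P(1,5) inside_Int_outside[of "img ?C"] by blast
  qed
  then have th: "inside (img ?C) \<subseteq> inside (img P1 \<union> img P) \<or> inside (img ?C) \<subseteq> inside (img P2 \<union> img P)"
    using theta_outside[OF g1(1) g2(1) g(1) g1(2,3) g2(2,3) g(2,3)] g1 g2 g I P(2) by (simp add: img_Un)
  \<comment> \<open>Here \<open>Q2\<close> is the side that the new cycle leaves out; both
    \<open>P1\<close> and \<open>P2\<close> can play this role.\<close>
  have main: "card (Ein ?C) < card (Ein (Q1 \<union> P))"
    if Q: "?C = Q1 \<union> Q2" "Q1 \<inter> Q2 = {}" "Q2 \<noteq> {}" "inside (img ?C) \<subseteq> inside (img (Q1 \<union> P))"
      "img Q1 \<inter> img Q2 = {p a, p b}" "img Q2 \<inter> img P = {p a, p b}"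
      "arc h1" "pathstart h1 = p a" "pathfinish h1 = p b" "path_image h1 = img Q1"
      "arc h2" "pathstart h2 = p a" "pathfinish h2 = p b" "path_image h2 = img Q2" for Q1 Q2 h1 h2
  proof -
    have "closed (img (Q1 \<union> P))" using compact_img[of "Q1 \<union> P"] Q(1) CF P(5) by (auto intro: compact_imp_closed)
    moreover have "img (Q1 \<union> P) \<inter> img Q2 = {p a, p b}"
      unfolding img_Un Int_Un_distrib2 using Q(5,6) by (simp add: Int_commute)
    ultimately have "img Q2 - {p a, p b} \<subseteq> inside (img (Q1 \<union> P))"
      using inside_subset_curve[OF Q(7,11,8,9,12,13), of "img (Q1 \<union> P)"] Q(1,4,5,10,14) by (simp add: img_Un)
    then have "Q2 \<subseteq> Ein (Q1 \<union> P)"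
      using opn_img_minus_ends[of _ Q2 a b] abW Q(1) CF by (fastforce simp: Ein_def)
    moreover have "Ein ?C \<subseteq> Ein (Q1 \<union> P)" using Q(4) by (auto simp: Ein_def)
    moreover have "Q2 \<inter> Ein ?C = {}" using Ein_disjoint[of ?C] Q(1) by auto
    ultimately have "Ein ?C \<subset> Ein (Q1 \<union> P)" using Q(3) by blast
    then show ?thesis by (intro psubset_card_mono finite_Ein)
  qed
  have "P1 \<noteq> {}" using g1 by (auto simp: img_def)
  from th show ?thesis
  proof
    assume "inside (img ?C) \<subseteq> inside (img P1 \<union> img P)"
    then have "card (Ein ?C) < card (Ein (P1 \<union> P))"
      using P I g1 g2 by (intro main[of P1 P2 g1 g2]) (auto simp: img_Un)
    then show ?thesis using c1 by metis
  next
    assume "inside (img ?C) \<subseteq> inside (img P2 \<union> img P)"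
    then have "card (Ein ?C) < card (Ein (P2 \<union> P))"
      using P I g1 g2 \<open>P1 \<noteq> {}\<close> by (intro main[of P2 P1 g2 g1]) (auto simp: img_Un)
    then show ?thesis using c2 by metis
  qed
qed

text \<open>When the number of edges inside is maximal, every edge lies inside the cycle or on it.
  For a cycle of length \<open>n\<close>, the bound on its inside contributes \<open>n\<close> and
  its own edges cost at most \<open>9 * n\<close>, while its vertices bring
  \<open>11 * n\<close>.\<close>

lemma nonseparable_sparse:
  assumes ns: nonseparable and girth: "\<And>vs. is_cycle F vs \<Longrightarrow> 11 \<le> length vs" and "is_cycle F vs"
  shows "9 * card F + 11 \<le> 11 * card W"
proof -
  obtain ws where ws: "is_cycle F ws" "\<And>us. is_cycle F us \<Longrightarrow> card (Ein (cedges us)) \<le> card (Ein (cedges ws))"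
  proof -
    have "card (Ein (cedges us)) < Suc (card F)" for us
      using card_mono[OF finF, of "Ein (cedges us)"] by (auto simp: Ein_def le_imp_less_Suc)
    then show ?thesis
      using ex_has_greatest_nat[of "is_cycle F" vs "\<lambda>us. card (Ein (cedges us))" "Suc (card F)"] assms(3) that by blast
  qed
  let ?C = "cedges ws"
  have CF: "?C \<subseteq> F" and len: "2 \<le> length ws" "distinct ws" using ws(1) by (auto simp: is_cycle_iff)
  have "F \<subseteq> Ein ?C \<union> ?C"
    using outside_edge_enlarges[OF ns ws(1)] ws(2) by (meson UnCI leD subsetI)
  then have "card F \<le> card (Ein ?C) + card ?C"
    by (meson card_Un_le card_mono finF finite_Ein finite_UnI CF finite_subset order_trans)
  moreover have "card ?C \<le> length ws" using card_pedges[of "ws @ [hd ws]"] by (simp add: cedges_def)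
  moreover have "card (Vin ?C) + length ws \<le> card W"
  proof -
    have U: "\<Union>?C = set ws" using len by (intro Union_cedges) auto
    have wsW: "set ws \<subseteq> W" using U CF edge_subset by blast
    have "Vin ?C \<inter> set ws = {}"
      using vertex_in_img[OF CF] U inside_no_overlap[of "img ?C"] by (fastforce simp: Vin_def)
    then have "card (Vin ?C \<union> set ws) = card (Vin ?C) + length ws"
      using len(2) finite_Vin by (simp add: card_Un_disjoint distinct_card)
    moreover have "Vin ?C \<union> set ws \<subseteq> W" using wsW by (auto simp: Vin_def)
    ultimately show ?thesis using card_mono[OF finW] by metis
  qed
  ultimately show ?thesis using inside_bound[OF ns girth ws(1)] girth[OF ws(1)] by linarith
qed

end

section \<open>From nonseparable graphs to all vertex sets\<close>

lemma (in plane_graph) card_le_if_low_degree: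
  assumes "card {u. {u, v} \<in> F} \<le> 1"
  shows "card F \<le> card (ind_edges F (W - {v})) + 1"
proof -
  have "{u. {u, v} \<in> F} \<subseteq> W" using edge_subset by blast
  then have fin: "finite {u. {u, v} \<in> F}" using finW finite_subset by blast
  have "F \<subseteq> ind_edges F (W - {v}) \<union> (\<lambda>u. {u, v}) ` {u. {u, v} \<in> F}"
  proof
    fix e assume e: "e \<in> F"
    show "e \<in> ind_edges F (W - {v}) \<union> (\<lambda>u. {u, v}) ` {u. {u, v} \<in> F}"
    proof (cases "v \<in> e")
      case True
      moreover obtain x y where "e = {x, y}" using e sg by (auto simp: simple_graph_def card_2_iff)
      ultimately obtain u where "e = {u, v}" by blast
      then show ?thesis using e by blast
    next
      case False
      then show ?thesis using e edge_subset[OF e] by (auto simp: ind_edges_def)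
    qed
  qed
  then have "card F \<le> card (ind_edges F (W - {v}) \<union> (\<lambda>u. {u, v}) ` {u. {u, v} \<in> F})"
    using fin finF by (intro card_mono) (auto simp: ind_edges_def)
  also have "\<dots> \<le> card (ind_edges F (W - {v})) + card ((\<lambda>u. {u, v}) ` {u. {u, v} \<in> F})"
    by (rule card_Un_le)
  also have "card ((\<lambda>u. {u, v}) ` {u. {u, v} \<in> F}) \<le> 1"
    using card_image_le[OF fin] assms order_trans by blast
  finally show ?thesis by simp
qed

text \<open>Strong induction on the size of \<open>X\<close>. A vertex of degree at most 1 brings 11
  and costs at most 9. Otherwise there is a cycle, and a nonseparable graph is covered by the bound
  above. In a separable one the bounds for the two parts are added, and the second constant 11 pays
  for the vertex they may share.\<close>

lemma planar_girth_sparse: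
  assumes "finite V" "simple_graph V E" "planar_drawing V E p \<gamma>"
    and girth: "\<And>vs. is_cycle E vs \<Longrightarrow> 11 \<le> length vs" and "X \<subseteq> V" "X \<noteq> {}"
  shows "9 * card (ind_edges E X) + 11 \<le> 11 * card X"
  using assms(5,6)
proof (induction "card X" arbitrary: X rule: less_induct)
  case less
  let ?F = "ind_edges E X"
  have finX: "finite X" using less.prems assms(1) finite_subset by blast
  interpret plane_graph X ?F p \<gamma>
  proof
    show "simple_graph X ?F" using assms(2) by (auto simp: simple_graph_def ind_edges_def)
    have sub: "p ` X \<subseteq> p ` V" and FE: "\<And>e. e \<in> ?F \<Longrightarrow> e \<in> E"
      using less.prems by (auto simp: ind_edges_def)
    note d = assms(3)[unfolded planar_drawing_def]
    show "planar_drawing X ?F p \<gamma>"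
      unfolding planar_drawing_def
    proof (intro conjI ballI impI)
      show "inj_on p X" using inj_on_subset[OF conjunct1[OF d] less.prems(1)] .
      show "arc (\<gamma> e)" "{pathstart (\<gamma> e), pathfinish (\<gamma> e)} = p ` e" if "e \<in> ?F" for e
        using d FE[OF that] by blast+
      show "path_image (\<gamma> e) \<inter> p ` X \<subseteq> p ` e" if "e \<in> ?F" for e
      proof -
        have "path_image (\<gamma> e) \<inter> p ` V \<subseteq> p ` e" using d FE[OF that] by blast
        then show ?thesis using sub by blast
      qed
      show "path_image (\<gamma> e) \<inter> path_image (\<gamma> f) \<subseteq> p ` (e \<inter> f)" if "e \<in> ?F" "f \<in> ?F" "e \<noteq> f" for e f
        using d FE that by blast
    qed
  qed (rule finX)
  have IH: "9 * card (ind_edges E Y) + 11 \<le> 11 * card Y" if "Y \<subset> X" "Y \<noteq> {}" for Y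
    using less.hyps[of Y] that less.prems psubset_card_mono[OF finX that(1)] by auto
  show ?case
  proof (cases "\<exists>v\<in>X. card {u. {u, v} \<in> ?F} \<le> 1")
    case True
    then obtain v where v: "v \<in> X" "card {u. {u, v} \<in> ?F} \<le> 1" by blast
    show ?thesis
    proof (cases "X = {v}")
      case True
      have "e \<notin> ?F" for e
        using sg True card_mono[of "{v}" e] by (auto simp: simple_graph_def)
      then have "?F = {}" by blast
      then show ?thesis using True by simp
    next
      case False
      have "ind_edges ?F (X - {v}) = ind_edges E (X - {v})" by (auto simp: ind_edges_def)
      then have "card ?F \<le> card (ind_edges E (X - {v})) + 1" using card_le_if_low_degree[OF v(2)] by simp
      moreover have "9 * card (ind_edges E (X - {v})) + 11 \<le> 11 * card (X - {v})"
        using v False by (intro IH) auto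
      moreover have "card X = card (X - {v}) + 1" using card.remove[OF finX v(1)] by simp
      ultimately show ?thesis by simp
    qed
  next
    case False
    then obtain vs where vs: "is_cycle ?F vs"
      using min_degree_2_cycle[OF finX less.prems(2) sg] by force
    have g: "11 \<le> length us" if "is_cycle ?F us" for us
      using that by (intro girth) (auto simp: is_cycle_iff ind_edges_def)
    show ?thesis
    proof (cases nonseparable)
      case True
      then show ?thesis using nonseparable_sparse g vs by blast
    next
      case False
      then obtain Y Z where YZ: "Y \<union> Z = X" "Y \<noteq> X" "Z \<noteq> X" "\<forall>e\<in>?F. e \<subseteq> Y \<or> e \<subseteq> Z" "\<not> 2 \<le> card (Y \<inter> Z)"
        unfolding nonseparable_def by blast
      have fin: "finite Y" "finite Z" using YZ(1) finX by auto
      have "9 * card (ind_edges E Y) + 11 \<le> 11 * card Y" "9 * card (ind_edges E Z) + 11 \<le> 11 * card Z"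
        using YZ by (intro IH; auto)+
      moreover have "card ?F \<le> card (ind_edges E Y) + card (ind_edges E Z)"
      proof -
        have "?F = ind_edges E Y \<union> ind_edges E Z" using YZ(1,4) by (auto simp: ind_edges_def)
        then show ?thesis using card_Un_le by metis
      qed
      moreover have "card Y + card Z \<le> card X + 1" using card_Un_Int[OF fin] YZ(1,5) by simp
      ultimately show ?thesis by linarith
    qed
  qed
qed

section \<open>Recoloring sparse graphs\<close>

text \<open>The subgraph induced on \<open>X\<close> is one of the finitely many over which the
  maximum is taken.\<close>

lemma mad_sparse:
  assumes "finite V" "simple_graph V E" "mad V E < 22 / 9" "X \<subseteq> V" "X \<noteq> {}"
  shows "9 * card (ind_edges E X) \<le> 11 * card X"
proof -
  let ?S = "{2 * real (card E') / real (card V') | V' E'. subgraph V' E' V E \<and> V' \<noteq> {}}"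
  have "finite E"
    using assms(1,2) by (intro finite_subset[of E "Pow V"]) (auto simp: simple_graph_def)
  then have "finite ((\<lambda>(V', E'). 2 * real (card E') / real (card V')) ` (Pow V \<times> Pow E))"
    using assms(1) by auto
  then have "finite ?S" by (rule finite_subset[rotated]) (auto simp: subgraph_def)
  moreover have "2 * real (card (ind_edges E X)) / real (card X) \<in> ?S"
  proof -
    have "subgraph X (ind_edges E X) V E"
      using assms by (auto simp: subgraph_def simple_graph_def ind_edges_def)
    then show ?thesis using assms(5) by blast
  qed
  ultimately have "2 * real (card (ind_edges E X)) / real (card X) \<le> mad V E"
    unfolding mad_def by (rule Max_ge)
  then have "2 * real (card (ind_edges E X)) / real (card X) < 22 / 9" using assms(3) by simp
  moreover have "0 < card X" using assms finite_subset card_gt_0_iff by blast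
  ultimately have "9 * real (card (ind_edges E X)) < 11 * real (card X)" by (simp add: field_simps)
  then show ?thesis by linarith
qed

lemma edges_in_graph:
  assumes "finite X" "simple_graph V E" "multigraph m" and m: "\<And>u v. m u v = (if {u, v} \<in> E then 1 else 0)"
  shows "edges_in m X \<le> card (ind_edges E X)"
  using assms(1)
proof induction
  case empty then show ?case by (simp add: edges_in_def dbl_def)
next
  case (insert v X)
  let ?N = "{u\<in>X. {v, u} \<in> E}"
  have "deg_in m X v = card ?N" using insert by (simp add: deg_in_def m sum.If_cases Int_def)
  then have "edges_in m (insert v X) = edges_in m X + card ?N"
    using edges_in_Un[OF assms(3), of "{v}" X] insert
    using assms(3) by (simp add: dbl_sing edges_in_def[of m "{v}"] deg_in_def[of m "{v}"] multigraph_def)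
  moreover have "card (ind_edges E X) + card ?N \<le> card (ind_edges E (insert v X))"
  proof -
    have fin: "finite (ind_edges E Y)" if "finite Y" for Y
      by (rule finite_subset[of _ "Pow Y"]) (use that in \<open>auto simp: ind_edges_def\<close>)
    have "inj_on (\<lambda>u. {v, u}) ?N" by (auto simp: inj_on_def doubleton_eq_iff)
    then have "card (ind_edges E X) + card ?N = card (ind_edges E X \<union> (\<lambda>u. {v, u}) ` ?N)"
      using insert fin by (subst card_Un_disjoint) (auto simp: card_image ind_edges_def)
    also have "\<dots> \<le> card (ind_edges E (insert v X))"
      using insert fin by (intro card_mono) (auto simp: ind_edges_def)
    finally show ?thesis .
  qed
  ultimately show ?case using insert by linarith
qed

lemma sparse_recoloring:
  assumes "finite V" "simple_graph V E" "list_assignment 4 V L" "L_coloring V E L \<alpha>" "L_coloring V E L \<beta>"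
    and sparse: "\<And>X. X \<subseteq> V \<Longrightarrow> X \<noteq> {} \<Longrightarrow> 9 * card (ind_edges E X) \<le> 11 * card X"
  shows "\<exists>\<phi>s. recoloring_sequence V E L \<phi>s \<and> transforms \<phi>s \<alpha> \<beta> \<and> (\<forall>v\<in>V. times_recolored \<phi>s v \<le> 14)"
proof -
  define m where "m u v = (if {u, v} \<in> E then 1 else 0 :: nat)" for u v
  have mg: "multigraph m"
    using assms(2) by (auto simp: multigraph_def m_def insert_commute simple_graph_def)
  \<comment> \<open>With all weights equal to 11 there are no roots and every cap is 14, so the
    order starts from the empty set.\<close>
  have "solvable m (\<lambda>_. 11) V"
  proof (rule solvable_if_pot_nonneg[OF mg assms(1)])
    fix X assume X: "X \<subseteq> V"
    then have "finite X" using assms(1) finite_subset by blast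
    then have "edges_in m X \<le> card (ind_edges E X)"
      by (rule edges_in_graph[OF _ assms(2) mg m_def])
    moreover have "9 * card (ind_edges E X) \<le> 11 * card X"
    proof (cases "X = {}")
      case True
      then have "ind_edges E X = {}" using assms(2) by (auto simp: ind_edges_def simple_graph_def)
      then show ?thesis by simp
    qed (use sparse X in auto)
    ultimately show "0 \<le> pot m (\<lambda>_. 11) X" by (simp add: pot_def)
  qed auto
  then obtain r where r: "built m r {} V" "\<And>v. v \<in> V \<Longrightarrow> r v \<le> 14"
    by (auto simp: solvable_def roots_def cap_def)
  obtain \<phi>s where \<phi>s: "recol E L V \<phi>s" "transforms \<phi>s (restrict \<alpha> V) (restrict \<beta> V)"
      "\<And>v. v \<in> V \<Longrightarrow> times_recolored \<phi>s v \<le> r v"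
    using recoloring_if_built[OF assms(1-3) m_def r(1) order_refl assms(4,5)] by blast
  have "ind_edges E V = E" using assms(2) by (auto simp: ind_edges_def simple_graph_def)
  moreover have "restrict \<alpha> V = \<alpha>" "restrict \<beta> V = \<beta>"
    using assms(4,5) by (auto simp: L_coloring_def PiE_restrict)
  ultimately show ?thesis using \<phi>s r(2) order_trans by (intro exI[of _ \<phi>s]) fastforce
qed

theorem theorem4:
  fixes V :: "'a set" and E :: "'a set set"
    and L :: "'a \<Rightarrow> 'c set" and \<alpha> \<beta> :: "'a \<Rightarrow> 'c"
  assumes "finite V" and "simple_graph V E"
    and "list_assignment 4 V L"
    and "L_coloring V E L \<alpha>" and "L_coloring V E L \<beta>"
  shows "(mad V E < 22 / 9 \<longrightarrow>
            (\<exists>\<phi>s. recoloring_sequence V E L \<phi>s \<and> transforms \<phi>s \<alpha> \<beta> \<and>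
                  (\<forall>v\<in>V. times_recolored \<phi>s v \<le> 14))) \<and>
         (planar V E \<and> girth E \<ge> 11 \<longrightarrow>
            (\<exists>\<phi>s. recoloring_sequence V E L \<phi>s \<and> transforms \<phi>s \<alpha> \<beta> \<and>
                  (\<forall>v\<in>V. times_recolored \<phi>s v \<le> 14)))"
proof (intro conjI impI)
  assume "mad V E < 22 / 9"
  then show "\<exists>\<phi>s. recoloring_sequence V E L \<phi>s \<and> transforms \<phi>s \<alpha> \<beta> \<and>
      (\<forall>v\<in>V. times_recolored \<phi>s v \<le> 14)"
    using mad_sparse[OF assms(1,2)] by (intro sparse_recoloring[OF assms]) blast
next
  assume pl: "planar V E \<and> girth E \<ge> 11"
  then obtain p \<gamma> where d: "planar_drawing V E p \<gamma>" by (auto simp: planar_def)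
  have g: "11 \<le> length vs" if "is_cycle E vs" for vs
  proof -
    have "girth E \<le> enat (length vs)" unfolding girth_def by (rule INF_lower) (use that in simp)
    then have "11 \<le> enat (length vs)" using pl order_trans by blast
    then show ?thesis by (simp add: numeral_eq_enat)
  qed
  show "\<exists>\<phi>s. recoloring_sequence V E L \<phi>s \<and> transforms \<phi>s \<alpha> \<beta> \<and>
      (\<forall>v\<in>V. times_recolored \<phi>s v \<le> 14)"
  proof (rule sparse_recoloring[OF assms])
    fix X assume "X \<subseteq> V" "X \<noteq> {}"
    then have "9 * card (ind_edges E X) + 11 \<le> 11 * card X"
      using planar_girth_sparse[OF assms(1,2) d, of X] g by blast
    then show "9 * card (ind_edges E X) \<le> 11 * card X" by simp
  qed
qed

end
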